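(* Let $n\ge2$, let $\mathfrak g$ be an $n$-Lie algebra and $E=\mathfrak g\oplus V$ a vector space containing $\mathfrak g$ with fixed complement $V$. Equivalence classes of compatible action data of $\mathfrak g$ through $V$ classify the extreme extending structures on $E$ up to $n$-Lie algebra isomorphisms which fix $\mathfrak g$ and induce the identity on $E/\mathfrak g$. Isomorphism classes of compatible action data classify them up to arbitrary isomorphisms which fix $\mathfrak g$ pointwise.
   Context: $K$ is a field of characteristic zero; vector spaces are over $K$, all maps are linear; a hat denotes omission. An $n$-Lie algebra is a vector space with an alternating $n$-linear bracket (an $n$-Lie bracket) satisfying $[z_1,\dots,z_{n-1},[w_1,\dots,w_n]]=\sum_{i=1}^n[w_1,\dots,w_{i-1},[z_1,\dots,z_{n-1},w_i],w_{i+1},\dots,w_n]$. An extreme extending structure on $E$ is an $n$-Lie bracket on $E$ restricting to the given bracket on $\mathfrak g$ and satisfying $[u_1,\dots,u_k,x_{k+1},\dots,x_n]_E=0$ for all $2\le k\le n-2$, $u_i\in V$, $x_j\in\mathfrak g$ (no condition if there is no such $k$, e.g. if $n=3$). An action datum of $\mathfrak g$ through $V$ is a sextuple $\Omega=(\rho_{\mathfrak g},\rho_V,\vartheta_V,\vartheta_{\mathfrak g},\omega,\{-,\dots,-\}_V)$ of linear maps $\rho_{\mathfrak g}:\bigwedge^{n-1}\mathfrak g\to\mathrm{End}(V)$, $\rho_V:\bigwedge^{n-1}V\to\mathrm{End}(\mathfrak g)$, $\vartheta_V:V\to\mathrm{Hom}(\bigwedge^{n-1}\mathfrak g,\mathfrak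 g)$, $\vartheta_{\mathfrak g}:\mathfrak g\to\mathrm{Hom}(\bigwedge^{n-1}V,V)$, $\omega:\bigwedge^nV\to\mathfrak g$, $\{-,\dots,-\}_V:\bigwedge^nV\to V$. Define $$\begin{aligned}G(x_1,u_1;\dots;x_n,u_n)={}&[x_1,\dots,x_n]_{\mathfrak g}+\omega(u_1,\dots,u_n)+\sum_{i=1}^n(-1)^{i-1}\vartheta_V(u_i)(x_1,\dots,\widehat{x_i},\dots,x_n)\\&+\sum_{i=1}^n(-1)^{n-i}\rho_V(u_1,\dots,\widehat{u_i},\dots,u_n)x_i,\\ H(x_1,u_1;\dots;x_n,u_n)={}&\{u_1,\dots,u_n\}_V+\sum_{i=1}^n(-1)^{n-i}\rho_{\mathfrak g}(x_1,\dots,\widehat{x_i},\dots,x_n)u_i\\&+\sum_{i=1}^n(-1)^{n-i}\vartheta_{\mathfrak g}(x_i)(u_1,\dots,\widehat{u_i},\dots,u_n).\end{aligned}$$ The datum $\Omega$ corresponds to the operation $[x_1+u_1,\dots,x_n+u_n]_\Omega=G(x_1,u_1;\dots;x_n,u_n)+H(x_1,u_1;\dots;x_n,u_n)$ on $E=\mathfrak g\oplus V$. The datum is compatible if for all $x_1,\dots,x_{n-1},y_1,\dots,y_n\in\mathfrak g$, $u_1,\dots,u_{n-1},v_1,\dots,v_n\in V$, with $G_0=G(y_1,v_1;\dots;y_n,v_n)$, $H_0=H(y_1,v_1;\dots;y_n,v_n)$, $G_i=G(x_1,u_1;\dots;x_{n-1},u_{n-1};y_i,v_i)$, $H_i=H(x_1,u_1;\dots;x_{n-1},u_{n-1};y_i,v_i)$,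 one has for each $F\in\{G,H\}$ $$F(x_1,u_1;\dots;x_{n-1},u_{n-1};G_0,H_0)=\sum_{i=1}^nF(y_1,v_1;\dots;y_{i-1},v_{i-1};G_i,H_i;y_{i+1},v_{i+1};\dots;y_n,v_n).$$ Two compatible data $\Omega,\Omega'$ (maps of $\Omega'$ primed) are isomorphic if there are linear maps $r:V\to\mathfrak g$ and $s\in\mathrm{GL}(V)$ satisfying (a)–(d) below for all $u,u_i\in V$ and $x,x_i\in\mathfrak g$; they are equivalent if (a)–(d) hold for some $r$ with $s=\mathrm{id}_V$. (a) $\vartheta_V(u)(x_2,\dots,x_n)+(-1)^{n-1}r(\rho_{\mathfrak g}(x_2,\dots,x_n)u)=[r(u),x_2,\dots,x_n]_{\mathfrak g}+\vartheta'_V(s(u))(x_2,\dots,x_n)$ and $s(\rho_{\mathfrak g}(x_2,\dots,x_n)u)=\rho'_{\mathfrak g}(x_2,\dots,x_n)s(u)$. (b) For $2\le k\le n-2$: $0=[r(u_1),\dots,r(u_k),x_{k+1},\dots,x_n]_{\mathfrak g}+\sum_{i=1}^k(-1)^{i-1}\vartheta'_V(s(u_i))(r(u_1),\dots,\widehat{r(u_i)},\dots,r(u_k),x_{k+1},\dots,x_n)$ and $0=\sum_{i=1}^k(-1)^{n-i}\rho'_{\mathfrak g}(r(u_1),\dots,\widehat{r(u_i)},\dots,r(u_k),x_{k+1},\dots,x_n)s(u_i)$. (c) $\rho_V(u_1,\dots,u_{n-1})x+r(\vartheta_{\mathfrak g}(x)(u_1,\dots,u_{n-1}))=[r(u_1),\dots,r(u_{n-1}),x]_{\mathfrak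 g}+\sum_{i=1}^{n-1}(-1)^{i-1}\vartheta'_V(s(u_i))(r(u_1),\dots,\widehat{r(u_i)},\dots,r(u_{n-1}),x)+\rho'_V(s(u_1),\dots,s(u_{n-1}))x$ and $s(\vartheta_{\mathfrak g}(x)(u_1,\dots,u_{n-1}))=\sum_{i=1}^{n-1}(-1)^{n-i}\rho'_{\mathfrak g}(r(u_1),\dots,\widehat{r(u_i)},\dots,r(u_{n-1}),x)s(u_i)+\vartheta'_{\mathfrak g}(x)(s(u_1),\dots,s(u_{n-1}))$. (d) $\omega(u_1,\dots,u_n)+r(\{u_1,\dots,u_n\}_V)=[r(u_1),\dots,r(u_n)]_{\mathfrak g}+\omega'(s(u_1),\dots,s(u_n))+\sum_{i=1}^n(-1)^{i-1}\vartheta'_V(s(u_i))(r(u_1),\dots,\widehat{r(u_i)},\dots,r(u_n))+\sum_{i=1}^n(-1)^{n-i}\rho'_V(s(u_1),\dots,\widehat{s(u_i)},\dots,s(u_n))r(u_i)$ and $s(\{u_1,\dots,u_n\}_V)=\{s(u_1),\dots,s(u_n)\}'_V+\sum_{i=1}^n(-1)^{n-i}\rho'_{\mathfrak g}(r(u_1),\dots,\widehat{r(u_i)},\dots,r(u_n))s(u_i)+\sum_{i=1}^n(-1)^{n-i}\vartheta'_{\mathfrak g}(r(u_i))(s(u_1),\dots,\widehat{s(u_i)},\dots,s(u_n))$.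
   Formalization: For n=2 conditions (a) and (c) as written do not give a reflexive relation (g=V=K, zero bracket, θ_V(u)(x)=ux, rest 0), so for n=2 only they are replaced by the single condition that id+r+s carries [u,x]_Ω to [r(u)+s(u),x]_Ω'; n≥3 is as stated. *)

theory Defs
  imports "HOL-Analysis.Product_Vector"
begin

section \<open>Alternating maps and n-Lie brackets\<close>

text \<open>
  Vector spaces are whole types \<open>'a :: ab_group_add\<close> with an explicit scalar multiplication,
  as in \<^locale>\<open>vector_space\<close>. A tuple of \<open>k\<close> vectors is a list of length \<open>k\<close>; list positions
  start at \<open>0\<close>, so a sign \<open>(-1)^(i-1)\<close> or \<open>(-1)^(n-i)\<close> at a 1-based position \<open>i\<close> becomes
  \<open>(-1)^i\<close> or \<open>(-1)^(n-1-i)\<close>.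

  A linear map on the \<open>k\<close>-th exterior power is an alternating \<open>k\<close>-linear map. The
  value \<open>0\<close> off lists of length \<open>k\<close> makes equality of such functions equality of the maps.
\<close>

definition alternating_map ::
  "nat \<Rightarrow> ('k::field \<Rightarrow> 'a::ab_group_add \<Rightarrow> 'a) \<Rightarrow> ('k \<Rightarrow> 'b::ab_group_add \<Rightarrow> 'b) \<Rightarrow>
    ('a list \<Rightarrow> 'b) \<Rightarrow> bool" where
  "alternating_map k sA sB f \<longleftrightarrow>
     (\<forall>xs i. length xs = k \<and> i < k \<longrightarrow> Vector_Spaces.linear sA sB (\<lambda>y. f (xs[i := y]))) \<and>
     (\<forall>xs. length xs = k \<and> \<not> distinct xs \<longrightarrow> f xs = 0) \<and>
     (\<forall>xs. length xs \<noteq> k \<longrightarrow> f xs = 0)"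

definition n_Lie_bracket ::
  "nat \<Rightarrow> ('k::field \<Rightarrow> 'a::ab_group_add \<Rightarrow> 'a) \<Rightarrow> ('a list \<Rightarrow> 'a) \<Rightarrow> bool" where
  "n_Lie_bracket n sA br \<longleftrightarrow>
     alternating_map n sA sA br \<and>
     (\<forall>zs ws. length zs = n - 1 \<and> length ws = n \<longrightarrow>
        br (zs @ [br ws]) = (\<Sum>i<n. br (ws[i := br (zs @ [ws ! i])])))"

definition n_Lie_isomorphism ::
  "nat \<Rightarrow> ('k::field \<Rightarrow> 'a::ab_group_add \<Rightarrow> 'a) \<Rightarrow> ('a list \<Rightarrow> 'a) \<Rightarrow> ('a list \<Rightarrow> 'a) \<Rightarrow>
    ('a \<Rightarrow> 'a) \<Rightarrow> bool" where
  "n_Lie_isomorphism n sA br br' f \<longleftrightarrow>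
     Vector_Spaces.linear sA sA f \<and> bij f \<and>
     (\<forall>zs. length zs = n \<longrightarrow> f (br zs) = br' (map f zs))"

definition omit :: "nat \<Rightarrow> 'a list \<Rightarrow> 'a list" where
  "omit i xs = take i xs @ drop (Suc i) xs"


section \<open>Extreme extending structures\<close>

text \<open>\<open>E = \<gg> \<oplus> V\<close> is the product type \<open>'g \<times> 'v\<close>.\<close>

definition in_g :: "'g \<Rightarrow> 'g \<times> 'v::zero" where
  "in_g x = (x, 0)"

definition in_V :: "'v \<Rightarrow> 'g::zero \<times> 'v" where
  "in_V u = (0, u)"

definition extreme_extending_structures ::
  "nat \<Rightarrow> ('k::field \<Rightarrow> 'g::ab_group_add \<Rightarrow> 'g) \<Rightarrow> ('k \<Rightarrow> 'v::ab_group_add \<Rightarrow> 'v) \<Rightarrow>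
    ('g list \<Rightarrow> 'g) \<Rightarrow> (('g \<times> 'v) list \<Rightarrow> 'g \<times> 'v) set" where
  "extreme_extending_structures n sG sV brG =
     {brE. n_Lie_bracket n (module_prod.scale sG sV) brE \<and>
        (\<forall>xs. length xs = n \<longrightarrow> brE (map in_g xs) = in_g (brG xs)) \<and>
        (\<forall>us xs. 2 \<le> length us \<and> length us + 2 \<le> n \<and> length us + length xs = n \<longrightarrow>
           brE (map in_V us @ map in_g xs) = 0)}"

definition structures_isomorphic_over_g ::
  "nat \<Rightarrow> ('k::field \<Rightarrow> 'g::ab_group_add \<Rightarrow> 'g) \<Rightarrow> ('k \<Rightarrow> 'v::ab_group_add \<Rightarrow> 'v) \<Rightarrow>
    (('g \<times> 'v) list \<Rightarrow> 'g \<times> 'v) \<Rightarrow> (('g \<times> 'v) list \<Rightarrow> 'g \<times> 'v) \<Rightarrow> bool" where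
  "structures_isomorphic_over_g n sG sV br br' \<longleftrightarrow>
     (\<exists>f. n_Lie_isomorphism n (module_prod.scale sG sV) br br' f \<and> (\<forall>x. f (in_g x) = in_g x))"

text \<open>A linear map that fixes \<open>\<gg>\<close> induces the identity on \<open>E/\<gg>\<close> iff it moves each vector
  by an element of \<open>\<gg>\<close>.\<close>

definition structures_equivalent ::
  "nat \<Rightarrow> ('k::field \<Rightarrow> 'g::ab_group_add \<Rightarrow> 'g) \<Rightarrow> ('k \<Rightarrow> 'v::ab_group_add \<Rightarrow> 'v) \<Rightarrow>
    (('g \<times> 'v) list \<Rightarrow> 'g \<times> 'v) \<Rightarrow> (('g \<times> 'v) list \<Rightarrow> 'g \<times> 'v) \<Rightarrow> bool" where
  "structures_equivalent n sG sV br br' \<longleftrightarrow>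
     (\<exists>f. n_Lie_isomorphism n (module_prod.scale sG sV) br br' f \<and> (\<forall>x. f (in_g x) = in_g x) \<and>
        (\<forall>e. f e - e \<in> range in_g))"


section \<open>Compatible action data\<close>

record ('g, 'v) action_datum =
  rho_g :: "'g list \<Rightarrow> 'v \<Rightarrow> 'v"
  rho_V :: "'v list \<Rightarrow> 'g \<Rightarrow> 'g"
  theta_V :: "'v \<Rightarrow> 'g list \<Rightarrow> 'g"
  theta_g :: "'g \<Rightarrow> 'v list \<Rightarrow> 'v"
  omega :: "'v list \<Rightarrow> 'g"
  brV :: "'v list \<Rightarrow> 'v"

definition is_action_datum ::
  "nat \<Rightarrow> ('k::field \<Rightarrow> 'g::ab_group_add \<Rightarrow> 'g) \<Rightarrow> ('k \<Rightarrow> 'v::ab_group_add \<Rightarrow> 'v) \<Rightarrow>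
    ('g, 'v) action_datum \<Rightarrow> bool" where
  "is_action_datum n sG sV D \<longleftrightarrow>
     (\<forall>u. alternating_map (n - 1) sG sV (\<lambda>xs. rho_g D xs u)) \<and>
     (\<forall>xs. Vector_Spaces.linear sV sV (rho_g D xs)) \<and>
     (\<forall>x. alternating_map (n - 1) sV sG (\<lambda>us. rho_V D us x)) \<and>
     (\<forall>us. Vector_Spaces.linear sG sG (rho_V D us)) \<and>
     (\<forall>u. alternating_map (n - 1) sG sG (theta_V D u)) \<and>
     (\<forall>xs. Vector_Spaces.linear sV sG (\<lambda>u. theta_V D u xs)) \<and>
     (\<forall>x. alternating_map (n - 1) sV sV (theta_g D x)) \<and>
     (\<forall>us. Vector_Spaces.linear sG sV (\<lambda>x. theta_g D x us)) \<and>
     alternating_map n sV sG (omega D) \<and>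
     alternating_map n sV sV (brV D)"

definition datum_G ::
  "nat \<Rightarrow> ('k::field \<Rightarrow> 'g::ab_group_add \<Rightarrow> 'g) \<Rightarrow> ('g list \<Rightarrow> 'g) \<Rightarrow>
    ('g, 'v) action_datum \<Rightarrow> ('g \<times> 'v) list \<Rightarrow> 'g" where
  "datum_G n sG brG D zs =
     (let xs = map fst zs; us = map snd zs in
        brG xs + omega D us
        + (\<Sum>i<n. sG ((-1) ^ i) (theta_V D (us ! i) (omit i xs)))
        + (\<Sum>i<n. sG ((-1) ^ (n - 1 - i)) (rho_V D (omit i us) (xs ! i))))"

definition datum_H ::
  "nat \<Rightarrow> ('k::field \<Rightarrow> 'v::ab_group_add \<Rightarrow> 'v) \<Rightarrow>
    ('g, 'v) action_datum \<Rightarrow> ('g \<times> 'v) list \<Rightarrow> 'v" where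
  "datum_H n sV D zs =
     (let xs = map fst zs; us = map snd zs in
        brV D us
        + (\<Sum>i<n. sV ((-1) ^ (n - 1 - i)) (rho_g D (omit i xs) (us ! i)))
        + (\<Sum>i<n. sV ((-1) ^ (n - 1 - i)) (theta_g D (xs ! i) (omit i us))))"

definition datum_op ::
  "nat \<Rightarrow> ('k::field \<Rightarrow> 'g::ab_group_add \<Rightarrow> 'g) \<Rightarrow> ('k \<Rightarrow> 'v::ab_group_add \<Rightarrow> 'v) \<Rightarrow>
    ('g list \<Rightarrow> 'g) \<Rightarrow> ('g, 'v) action_datum \<Rightarrow> ('g \<times> 'v) list \<Rightarrow> 'g \<times> 'v" where
  "datum_op n sG sV brG D zs =
     (if length zs = n then (datum_G n sG brG D zs, datum_H n sV D zs) else 0)"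

definition compatible_data ::
  "nat \<Rightarrow> ('k::field \<Rightarrow> 'g::ab_group_add \<Rightarrow> 'g) \<Rightarrow> ('k \<Rightarrow> 'v::ab_group_add \<Rightarrow> 'v) \<Rightarrow>
    ('g list \<Rightarrow> 'g) \<Rightarrow> ('g, 'v) action_datum set" where
  "compatible_data n sG sV brG =
     {D. is_action_datum n sG sV D \<and>
        (\<forall>ws zs. length ws = n - 1 \<and> length zs = n \<longrightarrow>
          (let G = datum_G n sG brG D; H = datum_H n sV D;
               e0 = (G zs, H zs);
               e = (\<lambda>i. (G (ws @ [zs ! i]), H (ws @ [zs ! i])))
           in G (ws @ [e0]) = (\<Sum>i<n. G (zs[i := e i])) \<and>
              H (ws @ [e0]) = (\<Sum>i<n. H (zs[i := e i]))))}"


section \<open>Equivalent and isomorphic data\<close>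

text \<open>
  Conditions (a) to (d) compare the two brackets on tuples with, respectively, \<open>1\<close>,
  \<open>2 \<le> k \<le> n - 2\<close>, \<open>n - 1\<close> and \<open>n\<close> entries in \<open>V\<close>.
\<close>

definition cond_a ::
  "nat \<Rightarrow> ('k::field \<Rightarrow> 'g::ab_group_add \<Rightarrow> 'g) \<Rightarrow> ('g list \<Rightarrow> 'g) \<Rightarrow>
    ('g, 'v) action_datum \<Rightarrow> ('g, 'v) action_datum \<Rightarrow> ('v \<Rightarrow> 'g) \<Rightarrow> ('v \<Rightarrow> 'v) \<Rightarrow> bool" where
  "cond_a n sG brG D D' r s \<longleftrightarrow>
     (\<forall>u xs. length xs = n - 1 \<longrightarrow>
        theta_V D u xs + sG ((-1) ^ (n - 1)) (r (rho_g D xs u))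
          = brG (r u # xs) + theta_V D' (s u) xs \<and>
        s (rho_g D xs u) = rho_g D' xs (s u))"

definition cond_b ::
  "nat \<Rightarrow> ('k::field \<Rightarrow> 'g::ab_group_add \<Rightarrow> 'g) \<Rightarrow> ('k \<Rightarrow> 'v::ab_group_add \<Rightarrow> 'v) \<Rightarrow>
    ('g list \<Rightarrow> 'g) \<Rightarrow> ('g, 'v) action_datum \<Rightarrow> ('v \<Rightarrow> 'g) \<Rightarrow> ('v \<Rightarrow> 'v) \<Rightarrow> bool" where
  "cond_b n sG sV brG D' r s \<longleftrightarrow>
     (\<forall>us xs. 2 \<le> length us \<and> length us + 2 \<le> n \<and> length us + length xs = n \<longrightarrow>
        0 = brG (map r us @ xs)
            + (\<Sum>i<length us. sG ((-1) ^ i) (theta_V D' (s (us ! i)) (omit i (map r us) @ xs))) \<and>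
        0 = (\<Sum>i<length us.
               sV ((-1) ^ (n - 1 - i)) (rho_g D' (omit i (map r us) @ xs) (s (us ! i)))))"

definition cond_c ::
  "nat \<Rightarrow> ('k::field \<Rightarrow> 'g::ab_group_add \<Rightarrow> 'g) \<Rightarrow> ('k \<Rightarrow> 'v::ab_group_add \<Rightarrow> 'v) \<Rightarrow>
    ('g list \<Rightarrow> 'g) \<Rightarrow> ('g, 'v) action_datum \<Rightarrow> ('g, 'v) action_datum \<Rightarrow>
    ('v \<Rightarrow> 'g) \<Rightarrow> ('v \<Rightarrow> 'v) \<Rightarrow> bool" where
  "cond_c n sG sV brG D D' r s \<longleftrightarrow>
     (\<forall>us x. length us = n - 1 \<longrightarrow>
        rho_V D us x + r (theta_g D x us)
          = brG (map r us @ [x])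
            + (\<Sum>i<n - 1. sG ((-1) ^ i) (theta_V D' (s (us ! i)) (omit i (map r us) @ [x])))
            + rho_V D' (map s us) x \<and>
        s (theta_g D x us)
          = (\<Sum>i<n - 1.
               sV ((-1) ^ (n - 1 - i)) (rho_g D' (omit i (map r us) @ [x]) (s (us ! i))))
            + theta_g D' x (map s us))"

definition cond_d ::
  "nat \<Rightarrow> ('k::field \<Rightarrow> 'g::ab_group_add \<Rightarrow> 'g) \<Rightarrow> ('k \<Rightarrow> 'v::ab_group_add \<Rightarrow> 'v) \<Rightarrow>
    ('g list \<Rightarrow> 'g) \<Rightarrow> ('g, 'v) action_datum \<Rightarrow> ('g, 'v) action_datum \<Rightarrow>
    ('v \<Rightarrow> 'g) \<Rightarrow> ('v \<Rightarrow> 'v) \<Rightarrow> bool" where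
  "cond_d n sG sV brG D D' r s \<longleftrightarrow>
     (\<forall>us. length us = n \<longrightarrow>
        omega D us + r (brV D us)
          = brG (map r us) + omega D' (map s us)
            + (\<Sum>i<n. sG ((-1) ^ i) (theta_V D' (s (us ! i)) (omit i (map r us))))
            + (\<Sum>i<n. sG ((-1) ^ (n - 1 - i)) (rho_V D' (omit i (map s us)) (r (us ! i)))) \<and>
        s (brV D us)
          = brV D' (map s us)
            + (\<Sum>i<n. sV ((-1) ^ (n - 1 - i)) (rho_g D' (omit i (map r us)) (s (us ! i))))
            + (\<Sum>i<n. sV ((-1) ^ (n - 1 - i)) (theta_g D' (r (us ! i)) (omit i (map s us)))))"

text \<open>
  For \<open>n = 2\<close> the cases \<open>k = 1\<close> and \<open>k = n - 1\<close> are the same bracket \<open>[u, x]\<close>, to which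
  \<open>theta_V\<close>, \<open>rho_V\<close>, \<open>rho_g\<close> and \<open>theta_g\<close> all contribute. Imposing (a) and (c) separately would
  then not even be reflexive (take \<open>r = 0\<close>, \<open>s = id\<close> in (c)), so for \<open>n = 2\<close> they are replaced by
  the single comparison of the two components of \<open>[u, x]\<close>.
\<close>

definition cond_ac2 ::
  "('g list \<Rightarrow> 'g) \<Rightarrow> ('g::ab_group_add, 'v::ab_group_add) action_datum \<Rightarrow>
    ('g, 'v) action_datum \<Rightarrow> ('v \<Rightarrow> 'g) \<Rightarrow> ('v \<Rightarrow> 'v) \<Rightarrow> bool" where
  "cond_ac2 brG D D' r s \<longleftrightarrow>
     (\<forall>u x.
        theta_V D u [x] + rho_V D [u] x + r (theta_g D x [u] - rho_g D [x] u)
          = brG [r u, x] + theta_V D' (s u) [x] + rho_V D' [s u] x \<and>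
        s (theta_g D x [u] - rho_g D [x] u) = theta_g D' x [s u] - rho_g D' [x] (s u))"

definition datum_conditions ::
  "nat \<Rightarrow> ('k::field \<Rightarrow> 'g::ab_group_add \<Rightarrow> 'g) \<Rightarrow> ('k \<Rightarrow> 'v::ab_group_add \<Rightarrow> 'v) \<Rightarrow>
    ('g list \<Rightarrow> 'g) \<Rightarrow> ('g, 'v) action_datum \<Rightarrow> ('g, 'v) action_datum \<Rightarrow>
    ('v \<Rightarrow> 'g) \<Rightarrow> ('v \<Rightarrow> 'v) \<Rightarrow> bool" where
  "datum_conditions n sG sV brG D D' r s \<longleftrightarrow>
     (if n = 2 then cond_ac2 brG D D' r s
      else cond_a n sG brG D D' r s \<and> cond_c n sG sV brG D D' r s) \<and>
     cond_b n sG sV brG D' r s \<and> cond_d n sG sV brG D D' r s"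

definition data_isomorphic ::
  "nat \<Rightarrow> ('k::field \<Rightarrow> 'g::ab_group_add \<Rightarrow> 'g) \<Rightarrow> ('k \<Rightarrow> 'v::ab_group_add \<Rightarrow> 'v) \<Rightarrow>
    ('g list \<Rightarrow> 'g) \<Rightarrow> ('g, 'v) action_datum \<Rightarrow> ('g, 'v) action_datum \<Rightarrow> bool" where
  "data_isomorphic n sG sV brG D D' \<longleftrightarrow>
     (\<exists>r s. Vector_Spaces.linear sV sG r \<and> Vector_Spaces.linear sV sV s \<and> bij s \<and>
        datum_conditions n sG sV brG D D' r s)"

definition data_equivalent ::
  "nat \<Rightarrow> ('k::field \<Rightarrow> 'g::ab_group_add \<Rightarrow> 'g) \<Rightarrow> ('k \<Rightarrow> 'v::ab_group_add \<Rightarrow> 'v) \<Rightarrow>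
    ('g list \<Rightarrow> 'g) \<Rightarrow> ('g, 'v) action_datum \<Rightarrow> ('g, 'v) action_datum \<Rightarrow> bool" where
  "data_equivalent n sG sV brG D D' \<longleftrightarrow>
     (\<exists>r. Vector_Spaces.linear sV sG r \<and> datum_conditions n sG sV brG D D' r id)"


section \<open>Classification\<close>

definition rel_on :: "'a set \<Rightarrow> ('a \<Rightarrow> 'a \<Rightarrow> bool) \<Rightarrow> ('a \<times> 'a) set" where
  "rel_on A R = {(a, b). a \<in> A \<and> b \<in> A \<and> R a b}"

text \<open>
  The classes of \<open>A\<close> modulo \<open>R\<close> classify \<open>B\<close> modulo \<open>S\<close> via \<open>f\<close>: both are equivalence relations
  and \<open>f\<close> induces a well-defined bijection of the quotients. Well-definedness is part of the
  \<^const>\<open>bij_betw\<close> statement, since \<open>rel_on B S `` (f ` C)\<close>, the union of the \<open>S\<close>-classes met by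
  \<open>f ` C\<close>, has to be a single class.
\<close>

definition classifies_via ::
  "('a \<Rightarrow> 'b) \<Rightarrow> 'a set \<Rightarrow> ('a \<Rightarrow> 'a \<Rightarrow> bool) \<Rightarrow> 'b set \<Rightarrow> ('b \<Rightarrow> 'b \<Rightarrow> bool) \<Rightarrow> bool" where
  "classifies_via f A R B S \<longleftrightarrow>
     f ` A \<subseteq> B \<and> equiv A (rel_on A R) \<and> equiv B (rel_on B S) \<and>
     bij_betw (\<lambda>C. rel_on B S `` (f ` C)) (A // rel_on A R) (B // rel_on B S)"

end

theory Submission
  imports Defs
begin

text \<open>
  An extreme extending structure is the same thing as the operation of a compatible datum, and the
  conditions relating two data say that a certain linear map is a morphism of these operations.

  An alternating map on \<open>E = \<gg> \<oplus> V\<close> is determined by its values on sorted tuples, whose first \<open>k\<close>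
  entries lie in \<open>V\<close> and whose other entries lie in \<open>\<gg>\<close> (\<open>alternating_map_eqI\<close>). The operation of an
  action datum is alternating, being built from pullbacks of alternating maps and antisymmetrized
  products (\<open>alternating_map_wedge\<close>), and compatibility of the datum is the \<open>n\<close>-Lie identity for it,
  written in components (\<open>compatible_data_iff\<close>). On sorted tuples the operation is the bracket of
  \<open>\<gg>\<close> for \<open>k = 0\<close>, is given by \<open>theta_V\<close> and \<open>rho_g\<close> for \<open>k = 1\<close>, by \<open>rho_V\<close> and \<open>theta_g\<close> for
  \<open>k = n - 1\<close>, by \<open>omega\<close> and \<open>brV\<close> for \<open>k = n\<close>, and vanishes for the other \<open>k\<close> (\<open>datum_op_pure\<close>).
  So it is an extreme extending structure, and conversely the components of any such structure on
  sorted tuples form a datum that gives it back (\<open>datum_op_datum_of\<close>). For \<open>n = 2\<close> the cases \<open>k = 1\<close>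
  and \<open>k = n - 1\<close> coincide and different data can have the same operation; this is harmless, since
  only classes of data are compared.

  A linear map of \<open>E\<close> that fixes \<open>\<gg>\<close> has the form \<open>(x, u) \<mapsto> (x + r u, s u)\<close>. It is bijective iff \<open>s\<close>
  is, and induces the identity on \<open>E/\<gg>\<close> iff \<open>s = id\<close>. It is a morphism of the operations of two data
  iff the morphism equation holds on sorted tuples; the equations for \<open>k \<ge> 1\<close> are the conditions
  (a) to (d), and the one for \<open>k = 0\<close> holds anyway (\<open>shear_hom_iff_conds\<close>). Hence two compatible data
  are equivalent or isomorphic exactly when their operations are, and a surjection with this
  property induces a bijection of classes (\<open>classifies_viaI\<close>).
\<close>

section \<open>Alternating maps\<close>

lemma linear_map_zero:
  assumes "Vector_Spaces.linear sA sB f"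
  shows "f 0 = 0"
  using assms by (intro module_hom.zero[of sA sB f]) (simp add: module_hom_iff_linear)

lemma alternating_map_linear:
  assumes "alternating_map k sA sB f" and "length (xs @ ys) + 1 = k"
  shows "Vector_Spaces.linear sA sB (\<lambda>y. f (xs @ y # ys))"
proof -
  have "length (xs @ 0 # ys) = k \<and> length xs < k"
    using assms(2) by simp
  then have "Vector_Spaces.linear sA sB (\<lambda>y. f ((xs @ 0 # ys)[length xs := y]))"
    using assms(1) unfolding alternating_map_def by blast
  then show ?thesis
    by (simp add: list_update_append)
qed

lemma alternating_map_add:
  assumes "alternating_map k sA sB f" and "length (xs @ ys) + 1 = k"
  shows "f (xs @ (a + b) # ys) = f (xs @ a # ys) + f (xs @ b # ys)"
  using alternating_map_linear[OF assms] by (simp add: Vector_Spaces.linear_iff)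

lemma alternating_map_repeat:
  assumes "alternating_map k sA sB f" and "\<not> distinct xs"
  shows "f xs = 0"
  using assms by (cases "length xs = k") (auto simp: alternating_map_def)

lemma alternating_map_zero:
  assumes "alternating_map k sA sB f" and "0 \<in> set xs"
  shows "f xs = 0"
proof (cases "length xs = k")
  case True
  obtain ys zs where xs: "xs = ys @ 0 # zs"
    using assms(2) by (auto simp: in_set_conv_decomp)
  have "f (ys @ (0 + 0) # zs) = f (ys @ 0 # zs) + f (ys @ 0 # zs)"
    using True xs by (intro alternating_map_add[OF assms(1)]) simp
  then show ?thesis by (simp add: xs)
qed (use assms in \<open>auto simp: alternating_map_def\<close>)

lemma alternating_map_length:
  assumes "alternating_map k sA sB f" and "length xs \<noteq> k"
  shows "f xs = 0"
  using assms by (auto simp: alternating_map_def)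

text \<open>
  Polarization: \<open>f\<close> vanishes when the two neighbouring entries are both \<open>a + b\<close>, and of the four
  terms of the expansion the two with a repeated entry vanish as well.
\<close>

lemma alternating_map_swap:
  assumes f: "alternating_map k sA sB f"
  shows "f (xs @ a # b # ys) = - f (xs @ b # a # ys)"
proof (cases "length xs + length ys + 2 = k")
  case True
  let ?c = "a + b"
  have "0 = f (xs @ ?c # ?c # ys)"
    by (simp add: alternating_map_repeat[OF f])
  also have "\<dots> = f (xs @ a # ?c # ys) + f (xs @ b # ?c # ys)"
    using True by (intro alternating_map_add[OF f]) simp
  also have "f (xs @ a # ?c # ys) = f ((xs @ [a]) @ a # ys) + f ((xs @ [a]) @ b # ys)"
    using True by (subst alternating_map_add[OF f, symmetric]) simp_all
  also have "f (xs @ b # ?c # ys) = f ((xs @ [b]) @ a # ys) + f ((xs @ [b]) @ b # ys)"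
    using True by (subst alternating_map_add[OF f, symmetric]) simp_all
  finally show ?thesis
    by (simp add: alternating_map_repeat[OF f] eq_neg_iff_add_eq_0)
qed (simp add: alternating_map_length[OF f])

text \<open>
  Moving an entry past a block of neighbours costs one transposition for each of them.
\<close>

lemma alternating_map_move:
  assumes f: "alternating_map k sA sB f" and "vector_space sB"
  shows "f (xs @ ys @ a # zs) = sB ((-1) ^ length ys) (f (xs @ a # ys @ zs))"
proof (induction ys arbitrary: xs)
  interpret vector_space sB by fact
  case Nil
  show ?case by simp
next
  interpret vector_space sB by fact
  case (Cons y ys)
  have "f (xs @ (y # ys) @ a # zs) = sB ((-1) ^ length ys) (f (xs @ y # a # ys @ zs))"
    using Cons.IH[of "xs @ [y]"] by simp
  also have "f (xs @ y # a # ys @ zs) = - f (xs @ a # y # ys @ zs)"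
    by (rule alternating_map_swap[OF f])
  finally show ?case by simp
qed

lemma alternating_map_plus:
  assumes "alternating_map k sA sB f" and "alternating_map k sA sB g"
  shows "alternating_map k sA sB (\<lambda>xs. f xs + g xs)"
  using assms
  by (auto simp: alternating_map_def Vector_Spaces.linear_iff vector_space.vector_space_assms(1))

lemma alternating_map_compose:
  assumes "alternating_map k sA sB f" and "Vector_Spaces.linear sB sC h"
  shows "alternating_map k sA sC (\<lambda>xs. h (f xs))"
proof -
  have "h 0 = 0"
    by (rule linear_map_zero[OF assms(2)])
  then show ?thesis
    using assms by (auto simp: alternating_map_def Vector_Spaces.linear_iff)
qed

lemma alternating_map_pullback:
  fixes h :: "'e::ab_group_add \<Rightarrow> 'a::ab_group_add"
  assumes "alternating_map k sA sB f" and "Vector_Spaces.linear sE sA h"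
  shows "alternating_map k sE sB (\<lambda>xs. f (map h xs))"
  unfolding alternating_map_def
proof (intro conjI allI impI)
  fix xs :: "'e list" and i assume "length xs = k \<and> i < k"
  then have "Vector_Spaces.linear sA sB (\<lambda>y. f ((map h xs)[i := y]))"
    using assms(1) by (simp add: alternating_map_def)
  from Vector_Spaces.linear_compose[OF assms(2) this]
  show "Vector_Spaces.linear sE sB (\<lambda>y. f (map h (xs[i := y])))"
    by (simp add: map_update comp_def)
next
  fix xs :: "'e list" assume "length xs = k \<and> \<not> distinct xs"
  then show "f (map h xs) = 0"
    by (simp add: alternating_map_repeat[OF assms(1)] distinct_map)
next
  fix xs :: "'e list" assume "length xs \<noteq> k"
  then show "f (map h xs) = 0"
    by (simp add: alternating_map_length[OF assms(1)])
qed

lemma alternating_map_Pair: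
  assumes "alternating_map k sE sA f" and "alternating_map k sE sB g"
    and "vector_space sA" and "vector_space sB"
  shows "alternating_map k sE (module_prod.scale sA sB) (\<lambda>xs. (f xs, g xs))"
proof -
  interpret vector_space_pair sA sB
    using assms(3,4) by (simp add: vector_space_pair_def)
  interpret vector_space_prod sA sB ..
  have "vector_space scale" ..
  then show ?thesis
    using assms(1,2)
    by (auto simp: alternating_map_def Vector_Spaces.linear_iff scale_prod zero_prod_def)
qed

lemma alternating_map_scale:
  assumes "alternating_map k sA sB f" and "vector_space sB"
  shows "alternating_map k sA sB (\<lambda>xs. sB c (f xs))"
proof -
  interpret vector_space sB by fact
  have "Vector_Spaces.linear sB sB (sB c)"
    unfolding Vector_Spaces.linear_iff
    using vector_space_axioms by (simp add: scale_right_distrib mult.commute)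
  then show ?thesis by (rule alternating_map_compose[OF assms(1)])
qed

lemma alternating_map_null:
  assumes "vector_space sA" and "vector_space sB"
  shows "alternating_map k sA sB (\<lambda>xs. 0)"
  using assms
  by (simp add: alternating_map_def vector_space_pair.linear_zero vector_space_pair_def)

lemma alternating_map_Cons:
  assumes f: "alternating_map (Suc k) sA sB f"
  shows "alternating_map k sA sB (\<lambda>xs. f (a # xs))"
  unfolding alternating_map_def
proof (intro conjI allI impI)
  fix xs :: "'b list" and i assume "length xs = k \<and> i < k"
  then have "length (a # xs) = Suc k \<and> Suc i < Suc k" by simp
  then have "Vector_Spaces.linear sA sB (\<lambda>y. f ((a # xs)[Suc i := y]))"
    using f unfolding alternating_map_def by blast
  then show "Vector_Spaces.linear sA sB (\<lambda>y. f (a # xs[i := y]))" by simp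
qed (auto simp: alternating_map_repeat[OF f] alternating_map_length[OF f])

lemma alternating_map_snoc:
  assumes f: "alternating_map (Suc k) sA sB f"
  shows "alternating_map k sA sB (\<lambda>xs. f (xs @ [a]))"
  unfolding alternating_map_def
proof (intro conjI allI impI)
  fix xs :: "'b list" and i assume xs: "length xs = k \<and> i < k"
  then have "length (xs @ [a]) = Suc k \<and> i < Suc k" by simp
  then have "Vector_Spaces.linear sA sB (\<lambda>y. f ((xs @ [a])[i := y]))"
    using f unfolding alternating_map_def by blast
  then show "Vector_Spaces.linear sA sB (\<lambda>y. f (xs[i := y] @ [a]))"
    using xs by (simp add: list_update_append)
qed (auto simp: alternating_map_repeat[OF f] alternating_map_length[OF f])

text \<open>
  Off the right length the map is identically zero, which is linear as well.
\<close>

lemma alternating_map_linear_any: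
  assumes "alternating_map k sA sB f" and "vector_space sA" and "vector_space sB"
  shows "Vector_Spaces.linear sA sB (\<lambda>y. f (xs @ y # ys))"
proof (cases "length (xs @ ys) + 1 = k")
  case False
  then have "(\<lambda>y. f (xs @ y # ys)) = (\<lambda>y. 0)"
    using alternating_map_length[OF assms(1)] by simp
  then show ?thesis
    using assms(2,3) by (simp add: vector_space_pair.linear_zero vector_space_pair_def)
qed (rule alternating_map_linear[OF assms(1)])

lemma alternating_map_cong:
  assumes "alternating_map k sA sB f"
    and "\<And>zs. length zs = k \<Longrightarrow> g zs = f zs" and "\<And>zs. length zs \<noteq> k \<Longrightarrow> g zs = 0"
  shows "alternating_map k sA sB g"
proof -
  have "g = f"
    using assms(2,3) alternating_map_length[OF assms(1)] by (metis ext)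
  with assms(1) show ?thesis by simp
qed

section \<open>Antisymmetrized products\<close>

lemma length_omit: "i < length zs \<Longrightarrow> length (omit i zs) = length zs - 1"
  by (simp add: omit_def)

lemma map_omit: "map h (omit i zs) = omit i (map h zs)"
  by (simp add: omit_def take_map drop_map)

lemma omit_append1: "i < length xs \<Longrightarrow> omit i (xs @ ys) = omit i xs @ ys"
  by (simp add: omit_def)

lemma omit_append2: "omit (length xs + i) (xs @ ys) = xs @ omit i ys"
  by (simp add: omit_def)

lemma omit_length: "omit (length xs) (xs @ y # ys) = xs @ ys"
  using omit_append2[of xs 0 "y # ys"] by (simp add: omit_def)

lemma omit_update_same: "omit j (zs[j := y]) = omit j zs"
  by (simp add: omit_def)

lemma omit_update_other:
  assumes "i \<noteq> j" and "i < length zs"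
  shows "omit i (zs[j := y]) = (omit i zs)[(if j < i then j else j - 1) := y]"
proof (cases "j < i")
  case False
  then obtain d where "j = Suc (i + d)"
    using assms(1) by (metis less_imp_Suc_add linorder_neqE_nat)
  then show ?thesis
    using assms(2) by (simp add: omit_def list_update_append drop_update_swap)
qed (use assms in \<open>auto simp: omit_def list_update_append take_update_swap\<close>)

lemma nth_in_set_omit:
  assumes "j < length zs" and "i \<noteq> j"
  shows "zs ! j \<in> set (omit i zs)"
proof (cases "j < i")
  case True
  then show ?thesis
    using assms by (auto simp: omit_def in_set_conv_nth intro!: exI[of _ j])
next
  case False
  then show ?thesis
    using assms by (auto simp: omit_def in_set_conv_nth intro!: disjI2 exI[of _ "j - Suc i"])
qed

text \<open>
  The summands of an antisymmetrized product that omit neither of two equal entries still see both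
  of them.
\<close>

lemma omit_not_distinct:
  assumes "p < length zs" "q < length zs" "p \<noteq> q" "zs ! p = zs ! q" "i \<noteq> p" "i \<noteq> q" "i < length zs"
  shows "\<not> distinct (omit i zs)"
proof -
  define r where "r j = (if j < i then j else j - 1)" for j
  have nth: "omit i zs ! r j = zs ! j" "r j < length (omit i zs)"
    if "j < length zs" "j \<noteq> i" for j
    using that assms(7) by (auto simp: omit_def nth_append r_def)
  have "r p \<noteq> r q" using assms by (auto simp: r_def)
  moreover have "omit i zs ! r p = omit i zs ! r q"
    using nth(1)[of p] nth(1)[of q] assms by simp
  moreover have "r p < length (omit i zs)" "r q < length (omit i zs)"
    using nth(2)[of p] nth(2)[of q] assms by simp_all
  ultimately show ?thesis
    unfolding distinct_conv_nth by blast
qed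

text \<open>
  The summand \<open>i\<close> feeds the \<open>i\<close>-th entry to the first argument of \<open>T\<close> and the remaining ones to
  the second. Up to a global sign, the four sums in the operation of an action datum have this
  shape. The sum runs over the length of the tuple, rather than over a fixed range, because then, for
  alternating \<open>T a\<close>, every summand vanishes on tuples of the wrong length.
\<close>

definition wedge ::
  "('k::field \<Rightarrow> 'c::ab_group_add \<Rightarrow> 'c) \<Rightarrow> ('a \<Rightarrow> 'b list \<Rightarrow> 'c) \<Rightarrow>
    ('e \<Rightarrow> 'a) \<Rightarrow> ('e \<Rightarrow> 'b) \<Rightarrow> 'e list \<Rightarrow> 'c" where
  "wedge sC T p q zs =
     (\<Sum>i<length zs. sC ((-1) ^ i) (T (p (zs ! i)) (map q (omit i zs))))"

text \<open>
  If two entries agree, only the two summands that omit one of them survive. Their omitted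
  lists differ by moving the common entry past the entries in between, and this sign together with
  the sign of the positions makes the two summands cancel.
\<close>

lemma alternating_map_wedge:
  assumes p: "Vector_Spaces.linear sE sA p" and q: "Vector_Spaces.linear sE sB q"
    and T1: "\<And>xs. Vector_Spaces.linear sA sC (\<lambda>a. T a xs)"
    and T2: "\<And>a. alternating_map m sB sC (T a)"
  shows "alternating_map (Suc m) sE sC (wedge sC T p q)"
proof -
  interpret E: vector_space sE using p by (simp add: Vector_Spaces.linear_iff)
  interpret C: vector_space sC using T1 by (simp add: Vector_Spaces.linear_iff)
  interpret EC: vector_space_pair sE sC ..
  have lin: "Vector_Spaces.linear sE sC (\<lambda>y. wedge sC T p q (zs[j := y]))"
    if zs: "length zs = Suc m" and j: "j < Suc m" for zs j
  proof -
    have "Vector_Spaces.linear sE sC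
        (\<lambda>y. T (p (zs[j := y] ! i)) (map q (omit i (zs[j := y]))))"
      if i: "i < Suc m" for i
    proof (cases "i = j")
      case True
      have "Vector_Spaces.linear sE sC ((\<lambda>a. T a (map q (omit i zs))) \<circ> p)"
        by (rule Vector_Spaces.linear_compose[OF p T1])
      then show ?thesis
        using True zs j by (simp add: omit_update_same comp_def)
    next
      case False
      define j' where "j' = (if j < i then j else j - 1)"
      have "j' < m" using False i j by (auto simp: j'_def)
      then have "Vector_Spaces.linear sB sC (\<lambda>b. T (p (zs ! i)) ((map q (omit i zs))[j' := b]))"
        using T2[of "p (zs ! i)"] zs i by (simp add: alternating_map_def length_omit)
      from Vector_Spaces.linear_compose[OF q this] show ?thesis
        using False i zs by (simp add: omit_update_other j'_def map_update comp_def)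
    qed
    then show ?thesis
      using zs unfolding wedge_def
      by (auto intro!: EC.linear_compose_sum EC.linear_compose_scale_right
          simp del: sum.lessThan_Suc)
  qed
  have alt: "wedge sC T p q zs = 0" if zs: "length zs = Suc m" and "\<not> distinct zs" for zs
  proof -
    \<comment> \<open>the equal entries sit at the positions \<open>i\<close> and \<open>j\<close>, separated by the block \<open>B\<close>\<close>
    obtain A B D a where "zs = A @ [a] @ B @ [a] @ D"
      using not_distinct_decomp[OF \<open>\<not> distinct zs\<close>] by blast
    then have dec: "zs = A @ a # B @ a # D" by simp
    define i where "i = length A"
    define j where "j = length A + Suc (length B)"
    define t where "t = (\<lambda>i. sC ((-1) ^ i) (T (p (zs ! i)) (map q (omit i zs))))"
    have ij: "i < length zs" "j < length zs" "i \<noteq> j"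
      by (auto simp: i_def j_def dec)
    have zi: "zs ! i = a" by (simp add: i_def dec)
    have zj: "zs ! j = a"
      by (simp add: j_def dec nth_append)
    have oi: "omit i zs = A @ B @ a # D"
      by (simp add: i_def dec omit_length)
    have oj: "omit j zs = A @ a # B @ D"
      using omit_length[of "A @ a # B" a D] by (simp add: j_def dec)
    have "wedge sC T p q zs = (\<Sum>k\<in>{i, j}. t k)"
      unfolding wedge_def t_def
    proof (rule sum.mono_neutral_right)
      show "\<forall>k\<in>{..<length zs} - {i, j}. sC ((-1) ^ k) (T (p (zs ! k)) (map q (omit k zs))) = 0"
      proof
        fix k assume "k \<in> {..<length zs} - {i, j}"
        then have "\<not> distinct (omit k zs)"
          using ij zi zj omit_not_distinct[of i zs j k] by auto
        then have "\<not> distinct (map q (omit k zs))"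
          by (simp add: distinct_map)
        then show "sC ((-1) ^ k) (T (p (zs ! k)) (map q (omit k zs))) = 0"
          by (simp add: alternating_map_repeat[OF T2])
      qed
    qed (use ij in auto)
    also have "\<dots> = t i + t j" using ij by simp
    also have "\<dots> = 0"
    proof -
      have "T (p a) (map q (A @ B @ a # D))
          = sC ((-1) ^ length B) (T (p a) (map q (A @ a # B @ D)))"
        using alternating_map_move[OF T2 C.vector_space_axioms, of "p a" "map q A" "map q B"] by simp
      moreover have "t i = sC ((-1) ^ i) (T (p a) (map q (A @ B @ a # D)))"
        unfolding t_def zi oi ..
      moreover have "t j = sC ((-1) ^ j) (T (p a) (map q (A @ a # B @ D)))"
        unfolding t_def zj oj ..
      ultimately show ?thesis
        by (simp add: i_def j_def power_add)
    qed
    finally show ?thesis .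
  qed
  have off: "wedge sC T p q zs = 0" if "length zs \<noteq> Suc m" for zs
    unfolding wedge_def
    using that by (intro sum.neutral) (auto simp: alternating_map_length[OF T2] length_omit)
  show ?thesis
    using lin alt off by (simp add: alternating_map_def)
qed

section \<open>Alternating maps on a direct sum\<close>

text \<open>
  Expanding each entry along \<open>E = \<gg> \<oplus> V\<close> and sorting the entries in \<open>V\<close> to the front writes every
  value as a signed sum of values on the sorted tuples. The induction does both at once: an entry
  is split, its component in \<open>\<gg>\<close> is appended to the block of entries in \<open>\<gg>\<close>, and its component in
  \<open>V\<close> is moved in front of that block.
\<close>

lemma alternating_map_eqI:
  fixes f f' :: "('g::ab_group_add \<times> 'v::ab_group_add) list \<Rightarrow> 'w::ab_group_add"
  assumes f: "alternating_map n sE sW f" and f': "alternating_map n sE sW f'"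
    and "vector_space sW"
    and eq: "\<And>us xs. length us + length xs = n \<Longrightarrow>
      f (map in_V us @ map in_g xs) = f' (map in_V us @ map in_g xs)"
    and zs: "length zs = n"
  shows "f zs = f' zs"
proof -
  have "f (map in_V us @ map in_g xs @ zs) = f' (map in_V us @ map in_g xs @ zs)"
    if "length us + length xs + length zs = n" for us xs
    using that
  proof (induction zs arbitrary: us xs)
    case Nil
    then show ?case using eq by simp
  next
    case (Cons z zs)
    obtain x u where z: "z = in_g x + in_V u"
      by (cases z) (simp add: in_g_def in_V_def)
    let ?A = "map in_V us" and ?B = "map in_g xs"
    have split: "h (?A @ ?B @ z # zs) = h ((?A @ ?B) @ in_g x # zs) + h ((?A @ ?B) @ in_V u # zs)"
      and move: "h ((?A @ ?B) @ in_V u # zs)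
        = sW ((-1) ^ length xs) (h (map in_V (us @ [u]) @ ?B @ zs))"
      if h: "alternating_map n sE sW h" for h
      using alternating_map_add[OF h, of "?A @ ?B" zs "in_g x" "in_V u"] Cons.prems
        alternating_map_move[OF h \<open>vector_space sW\<close>, of ?A ?B "in_V u" zs]
      by (simp_all add: z)
    have "f ((?A @ ?B) @ in_g x # zs) = f' ((?A @ ?B) @ in_g x # zs)"
      using Cons.IH[of us "xs @ [x]"] Cons.prems by simp
    moreover have "f (map in_V (us @ [u]) @ ?B @ zs) = f' (map in_V (us @ [u]) @ ?B @ zs)"
      using Cons.IH[of "us @ [u]" xs] Cons.prems by simp
    ultimately show ?case
      by (simp only: split[OF f] split[OF f'] move[OF f] move[OF f'])
  qed
  from this[of "[]" "[]"] show ?thesis using zs by simp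
qed

section \<open>Isomorphisms of structures\<close>

lemma n_Lie_isomorphism_id:
  assumes "vector_space sA"
  shows "n_Lie_isomorphism n sA br br id"
  using assms by (simp add: n_Lie_isomorphism_def vector_space.linear_id)

lemma n_Lie_isomorphism_comp:
  assumes "n_Lie_isomorphism n sA br br' f" and "n_Lie_isomorphism n sA br' br'' g"
  shows "n_Lie_isomorphism n sA br br'' (g \<circ> f)"
  using assms
  by (auto simp: n_Lie_isomorphism_def intro: Vector_Spaces.linear_compose bij_comp)

lemma n_Lie_isomorphism_inv:
  assumes "n_Lie_isomorphism n sA br br' f"
  shows "n_Lie_isomorphism n sA br' br (inv f)"
proof -
  have f: "Vector_Spaces.linear sA sA f" "bij f"
    and hom: "\<And>zs. length zs = n \<Longrightarrow> f (br zs) = br' (map f zs)"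
    using assms by (auto simp: n_Lie_isomorphism_def)
  have 1: "f (inv f x) = x" and 2: "inv f (f x) = x" for x
    using f(2) by (simp_all add: bij_is_surj surj_f_inv_f bij_is_inj)
  have "inv f (x + y) = inv f x + inv f y" for x y
  proof -
    have "f (inv f x + inv f y) = x + y"
      using f(1) by (simp add: Vector_Spaces.linear_iff 1)
    then show ?thesis using 2 by metis
  qed
  moreover have "inv f (sA c x) = sA c (inv f x)" for c x
  proof -
    have "f (sA c (inv f x)) = sA c x"
      using f(1) by (simp add: Vector_Spaces.linear_iff 1)
    then show ?thesis using 2 by metis
  qed
  moreover have "inv f (br' zs) = br (map (inv f) zs)" if "length zs = n" for zs
  proof -
    have "f (br (map (inv f) zs)) = br' zs"
      using hom[of "map (inv f) zs"] that by (simp add: 1 comp_def)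
    then show ?thesis using 2 by metis
  qed
  ultimately show ?thesis
    using f by (simp add: n_Lie_isomorphism_def Vector_Spaces.linear_iff bij_imp_bij_inv)
qed

lemma range_in_g_iff: "e \<in> range in_g \<longleftrightarrow> snd e = 0"
  by (cases e) (auto simp: in_g_def)

lemma structures_isomorphic_over_g_equiv:
  assumes "vector_space (module_prod.scale sG sV)"
  shows "equiv B (rel_on B (structures_isomorphic_over_g n sG sV))"
proof (rule equivI)
  let ?R = "structures_isomorphic_over_g n sG sV"
  show "refl_on B (rel_on B ?R)"
    using n_Lie_isomorphism_id[OF assms]
    by (auto simp: refl_on_def rel_on_def structures_isomorphic_over_g_def intro!: exI[of _ id])
  have "?R b a" if ab: "?R a b" for a b
  proof -
    obtain f where f: "n_Lie_isomorphism n (module_prod.scale sG sV) a b f"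
      "\<forall>x. f (in_g x) = in_g x"
      using ab by (auto simp: structures_isomorphic_over_g_def)
    then have "inv f (in_g x) = in_g x" for x
      by (metis bij_inv_eq_iff n_Lie_isomorphism_def)
    then show ?thesis
      using n_Lie_isomorphism_inv[OF f(1)] by (auto simp: structures_isomorphic_over_g_def)
  qed
  then show "sym (rel_on B ?R)"
    by (auto simp: sym_def rel_on_def)
  have "?R a c" if ab: "?R a b" and bc: "?R b c" for a b c
    using ab bc n_Lie_isomorphism_comp[of n "module_prod.scale sG sV" a b _ c]
    unfolding structures_isomorphic_over_g_def by (metis comp_apply)
  then show "trans (rel_on B ?R)"
    unfolding trans_def rel_on_def by blast
qed (auto simp: rel_on_def)

lemma structures_equivalent_equiv:
  assumes "vector_space (module_prod.scale sG sV)"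
  shows "equiv B (rel_on B (structures_equivalent n sG sV))"
proof (rule equivI)
  let ?R = "structures_equivalent n sG sV"
  have R: "?R a b \<longleftrightarrow> (\<exists>f. n_Lie_isomorphism n (module_prod.scale sG sV) a b f \<and>
      (\<forall>x. f (in_g x) = in_g x) \<and> (\<forall>e. snd (f e) = snd e))" for a b
    by (simp add: structures_equivalent_def range_in_g_iff)
  show "refl_on B (rel_on B ?R)"
    using n_Lie_isomorphism_id[OF assms]
    by (auto simp: refl_on_def rel_on_def R intro!: exI[of _ id])
  have "?R b a" if ab: "?R a b" for a b
  proof -
    obtain f where f: "n_Lie_isomorphism n (module_prod.scale sG sV) a b f"
      "\<forall>x. f (in_g x) = in_g x" "\<forall>e. snd (f e) = snd e"
      using ab by (auto simp: R)
    have "bij f" using f(1) by (simp add: n_Lie_isomorphism_def)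
    then have "inv f (in_g x) = in_g x" "snd (inv f e) = snd e" for x e
      using f(2,3) by (metis bij_inv_eq_iff)+
    then show ?thesis
      using n_Lie_isomorphism_inv[OF f(1)] by (auto simp: R)
  qed
  then show "sym (rel_on B ?R)"
    by (auto simp: sym_def rel_on_def)
  have "?R a c" if ab: "?R a b" and bc: "?R b c" for a b c
    using ab bc n_Lie_isomorphism_comp[of n "module_prod.scale sG sV" a b _ c]
    unfolding R by (metis comp_apply)
  then show "trans (rel_on B ?R)"
    unfolding trans_def rel_on_def by blast
qed (auto simp: rel_on_def)

section \<open>Linear maps fixing \<open>\<gg>\<close>\<close>

text \<open>
  The block matrix with rows \<open>(1, r)\<close> and \<open>(0, s)\<close> with respect to \<open>E = \<gg> \<oplus> V\<close>.
\<close>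

definition shear :: "('v \<Rightarrow> 'g) \<Rightarrow> ('v \<Rightarrow> 'v) \<Rightarrow> 'g::plus \<times> 'v \<Rightarrow> 'g \<times> 'v" where
  "shear r s = (\<lambda>(x, u). (x + r u, s u))"

text \<open>
  On \<open>\<gg>\<close> such a map is the identity, so it is determined by the two components \<open>r\<close> and \<open>s\<close> of its
  restriction to \<open>V\<close>.
\<close>

lemma linear_fixing_g_iff_shear:
  fixes sG :: "'k::field \<Rightarrow> 'g::ab_group_add \<Rightarrow> 'g"
    and sV :: "'k \<Rightarrow> 'v::ab_group_add \<Rightarrow> 'v"
  assumes "vector_space sG" and "vector_space sV"
  shows "Vector_Spaces.linear (module_prod.scale sG sV) (module_prod.scale sG sV) f \<and>
      (\<forall>x. f (in_g x) = in_g x) \<longleftrightarrow>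
    (\<exists>r s. Vector_Spaces.linear sV sG r \<and> Vector_Spaces.linear sV sV s \<and> f = shear r s)"
    (is "?L \<longleftrightarrow> ?R")
proof -
  interpret G: vector_space sG by fact
  interpret V: vector_space sV by fact
  interpret vector_space_prod sG sV ..
  have E: "vector_space scale" ..
  show ?thesis
  proof
    assume L: ?L
    then have add: "f (a + b) = f a + f b" and sc: "f (scale c a) = scale c (f a)" for a b c
      unfolding Vector_Spaces.linear_iff by blast+
    define r where "r u = fst (f (in_V u))" for u
    define s where "s u = snd (f (in_V u))" for u
    have in_V: "in_V (u + v) = (in_V u + in_V v :: 'g \<times> 'v)" "in_V (sV c u) = scale c (in_V u)" for u v c
      by (simp_all add: in_V_def scale_prod)
    have "fst (scale c z) = sG c (fst z)" "snd (scale c z) = sV c (snd z)" for c z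
      by (simp_all add: scale_def)
    then have rs: "Vector_Spaces.linear sV sG r" "Vector_Spaces.linear sV sV s"
      unfolding Vector_Spaces.linear_iff
      by (simp_all add: r_def s_def in_V add sc G.vector_space_axioms V.vector_space_axioms)
    have "f (x, u) = shear r s (x, u)" for x u
    proof -
      have "f (x, u) = f (in_g x) + f (in_V u)"
        by (simp add: add[symmetric] in_g_def in_V_def)
      also have "\<dots> = in_g x + f (in_V u)" using L by simp
      finally show ?thesis
        by (simp add: shear_def r_def s_def in_g_def prod_eq_iff)
    qed
    then have "f = shear r s" by auto
    with rs show ?R by blast
  next
    assume ?R
    then obtain r s where rs: "Vector_Spaces.linear sV sG r" "Vector_Spaces.linear sV sV s"
      and f: "f = shear r s" by blast
    have "r 0 = 0" "s 0 = 0"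
      using rs by (simp_all add: linear_map_zero)
    then show ?L
      using rs E unfolding f Vector_Spaces.linear_iff
      by (auto simp: shear_def scale_prod in_g_def algebra_simps)
  qed
qed

lemma bij_shear_iff: "bij (shear r s) \<longleftrightarrow> bij s"
  for r :: "'v \<Rightarrow> 'g::ab_group_add"
proof
  assume b: "bij (shear r s)"
  show "bij s"
  proof (rule bijI)
    show "inj s"
    proof (rule injI)
      fix u v assume "s u = s v"
      then have "shear r s (- r u, u) = shear r s (- r v, v)"
        by (simp add: shear_def)
      then show "u = v"
        using b by (auto dest: bij_is_inj injD)
    qed
    show "surj s"
    proof (rule surjI)
      fix v
      show "s (snd (inv (shear r s) (0, v))) = v"
        using surj_f_inv_f[OF bij_is_surj[OF b], of "(0, v)"]
        by (simp add: shear_def split: prod.splits)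
    qed
  qed
next
  assume s: "bij s"
  show "bij (shear r s)"
  proof (rule o_bij)
    show "(\<lambda>(x, u). (x - r (inv s u), inv s u)) \<circ> shear r s = id"
      using s by (auto simp: shear_def fun_eq_iff bij_is_inj)
    show "shear r s \<circ> (\<lambda>(x, u). (x - r (inv s u), inv s u)) = id"
      using s by (auto simp: shear_def fun_eq_iff bij_is_surj surj_f_inv_f)
  qed
qed

lemma ex_shear_iff:
  "(\<exists>f. (\<exists>r s. P r \<and> Q s \<and> f = shear r s) \<and> X f) \<longleftrightarrow> (\<exists>r s. P r \<and> Q s \<and> X (shear r s))"
  by blast

lemma structures_isomorphic_over_g_iff_shear:
  assumes "vector_space sG" and "vector_space sV"
  shows "structures_isomorphic_over_g n sG sV br br' \<longleftrightarrow>
    (\<exists>r s. Vector_Spaces.linear sV sG r \<and> Vector_Spaces.linear sV sV s \<and> bij s \<and>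
      (\<forall>zs. length zs = n \<longrightarrow> shear r s (br zs) = br' (map (shear r s) zs)))"
proof -
  let ?sE = "module_prod.scale sG sV"
  have "structures_isomorphic_over_g n sG sV br br' \<longleftrightarrow>
    (\<exists>f. (Vector_Spaces.linear ?sE ?sE f \<and> (\<forall>x. f (in_g x) = in_g x)) \<and> bij f \<and>
      (\<forall>zs. length zs = n \<longrightarrow> f (br zs) = br' (map f zs)))"
    unfolding structures_isomorphic_over_g_def n_Lie_isomorphism_def by blast
  then show ?thesis
    unfolding linear_fixing_g_iff_shear[OF assms] ex_shear_iff bij_shear_iff .
qed

text \<open>
  The \<open>V\<close>-component of \<open>shear r s e - e\<close> is \<open>s u - u\<close>, so inducing the identity on \<open>E/\<gg>\<close> means
  \<open>s = id\<close>.
\<close>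

lemma structures_equivalent_iff_shear:
  fixes sG :: "'k::field \<Rightarrow> 'g::ab_group_add \<Rightarrow> 'g"
    and sV :: "'k \<Rightarrow> 'v::ab_group_add \<Rightarrow> 'v"
  assumes "vector_space sG" and "vector_space sV"
  shows "structures_equivalent n sG sV br br' \<longleftrightarrow>
    (\<exists>r. Vector_Spaces.linear sV sG r \<and>
      (\<forall>zs. length zs = n \<longrightarrow> shear r id (br zs) = br' (map (shear r id) zs)))"
proof -
  have id: "(\<forall>e. shear r s e - e \<in> range in_g) \<longleftrightarrow> s = id" for r :: "'v \<Rightarrow> 'g" and s
    by (auto simp: range_in_g_iff shear_def fun_eq_iff)
  have "structures_equivalent n sG sV br br' \<longleftrightarrow>
    (\<exists>r s. Vector_Spaces.linear sV sG r \<and> Vector_Spaces.linear sV sV s \<and> bij s \<and>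
      (\<forall>e. shear r s e - e \<in> range in_g) \<and>
      (\<forall>zs. length zs = n \<longrightarrow> shear r s (br zs) = br' (map (shear r s) zs)))"
  proof -
    let ?sE = "module_prod.scale sG sV"
    have "structures_equivalent n sG sV br br' \<longleftrightarrow>
      (\<exists>f. (Vector_Spaces.linear ?sE ?sE f \<and> (\<forall>x. f (in_g x) = in_g x)) \<and> bij f \<and>
        (\<forall>e. f e - e \<in> range in_g) \<and>
        (\<forall>zs. length zs = n \<longrightarrow> f (br zs) = br' (map f zs)))"
      unfolding structures_equivalent_def n_Lie_isomorphism_def by blast
    then show ?thesis
      unfolding linear_fixing_g_iff_shear[OF assms] ex_shear_iff bij_shear_iff .
  qed
  then show ?thesis
    unfolding id using vector_space.linear_id[OF assms(2)] bij_id by blast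
qed

section \<open>The operation of an action datum\<close>

locale split_extension = vector_space_prod sG sV
  for sG :: "'k::field \<Rightarrow> 'g::ab_group_add \<Rightarrow> 'g"
    and sV :: "'k \<Rightarrow> 'v::ab_group_add \<Rightarrow> 'v" +
  fixes brG :: "'g list \<Rightarrow> 'g" and n :: nat
  assumes n: "n \<ge> 2" and brG: "n_Lie_bracket n sG brG"
begin

abbreviation "op \<equiv> datum_op n sG sV brG"
abbreviation "conds \<equiv> datum_conditions n sG sV brG"
abbreviation "struct \<equiv> extreme_extending_structures n sG sV brG"

lemma vs_G: "vector_space sG" and vs_V: "vector_space sV" and vs_E: "vector_space scale"
  by unfold_locales

lemma alt_brG: "alternating_map n sG sG brG"
  using brG by (simp add: n_Lie_bracket_def)

text \<open>
  The signs \<open>(-1)^(n-1-i)\<close> and \<open>(-1)^i\<close> differ by a factor independent of \<open>i\<close>, which turns the sums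
  of an action datum into antisymmetrized products.
\<close>

lemma sum_sign_split:
  fixes sW :: "'k \<Rightarrow> 'w::ab_group_add \<Rightarrow> 'w"
  assumes "vector_space sW"
  shows "(\<Sum>i<n. sW ((-1) ^ (n - 1 - i)) (h i)) = sW ((-1) ^ (n - 1)) (\<Sum>i<n. sW ((-1) ^ i) (h i))"
proof -
  interpret W: vector_space sW by fact
  have "(-1) ^ (n - 1 - i) = (-1) ^ (n - 1) * ((-1) ^ i :: 'k)" if i: "i < n" for i
  proof -
    obtain d where d: "n = Suc (i + d)" using less_imp_Suc_add[OF i] by blast
    show ?thesis
      unfolding d by (cases "even i"; cases "even d"; simp)
  qed
  then have "(\<Sum>i<n. sW ((-1) ^ (n - 1 - i)) (h i)) = (\<Sum>i<n. sW ((-1) ^ (n - 1)) (sW ((-1) ^ i) (h i)))"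
    by (intro sum.cong refl) (simp only: lessThan_iff W.scale_scale)
  then show ?thesis by (simp only: W.scale_sum_right)
qed

context
  fixes D :: "('g, 'v) action_datum"
  assumes D: "is_action_datum n sG sV D"
begin

lemma alt_rho_g: "alternating_map (n - 1) sG sV (\<lambda>xs. rho_g D xs u)"
  and lin_rho_g: "Vector_Spaces.linear sV sV (\<lambda>u. rho_g D xs u)"
  and alt_rho_V: "alternating_map (n - 1) sV sG (\<lambda>us. rho_V D us x)"
  and lin_rho_V: "Vector_Spaces.linear sG sG (\<lambda>x. rho_V D us x)"
  and alt_theta_V: "alternating_map (n - 1) sG sG (theta_V D u)"
  and lin_theta_V: "Vector_Spaces.linear sV sG (\<lambda>u. theta_V D u xs)"
  and alt_theta_g: "alternating_map (n - 1) sV sV (theta_g D x)"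
  and lin_theta_g: "Vector_Spaces.linear sG sV (\<lambda>x. theta_g D x us)"
  and alt_omega: "alternating_map n sV sG (omega D)"
  and alt_brV: "alternating_map n sV sV (brV D)"
  using D by (simp_all add: is_action_datum_def)

lemma datum_G_wedge:
  assumes "length zs = n"
  shows "datum_G n sG brG D zs = brG (map fst zs) + omega D (map snd zs)
    + wedge sG (theta_V D) snd fst zs
    + sG ((-1) ^ (n - 1)) (wedge sG (\<lambda>x us. rho_V D us x) fst snd zs)"
  using assms unfolding datum_G_def Let_def sum_sign_split[OF vs_G]
  by (simp add: wedge_def map_omit del: sum.lessThan_Suc)

lemma datum_H_wedge:
  assumes "length zs = n"
  shows "datum_H n sV D zs = brV D (map snd zs)
    + sV ((-1) ^ (n - 1)) (wedge sV (\<lambda>u xs. rho_g D xs u) snd fst zs)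
    + sV ((-1) ^ (n - 1)) (wedge sV (theta_g D) fst snd zs)"
  using assms unfolding datum_H_def Let_def sum_sign_split[OF vs_V]
  by (simp add: wedge_def map_omit del: sum.lessThan_Suc)

lemma alternating_datum_op: "alternating_map n scale scale (op D)"
proof -
  have wedge: "alternating_map n scale sC (wedge sC T p q)"
    if "Vector_Spaces.linear scale sA p" "Vector_Spaces.linear scale sB q"
      "\<And>xs. Vector_Spaces.linear sA sC (\<lambda>a. T a xs)"
      "\<And>a. alternating_map (n - 1) sB sC (T a)"
    for sA :: "'k \<Rightarrow> 'x::ab_group_add \<Rightarrow> 'x" and sB :: "'k \<Rightarrow> 'y::ab_group_add \<Rightarrow> 'y"
      and sC :: "'k \<Rightarrow> 'z::ab_group_add \<Rightarrow> 'z" and T p q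
    using alternating_map_wedge[OF that] n by simp
  have "alternating_map n scale scale
    (\<lambda>zs. (brG (map fst zs) + omega D (map snd zs)
        + wedge sG (theta_V D) snd fst zs
        + sG ((-1) ^ (n - 1)) (wedge sG (\<lambda>x us. rho_V D us x) fst snd zs),
      brV D (map snd zs)
        + sV ((-1) ^ (n - 1)) (wedge sV (\<lambda>u xs. rho_g D xs u) snd fst zs)
        + sV ((-1) ^ (n - 1)) (wedge sV (theta_g D) fst snd zs)))"
    by (intro alternating_map_Pair alternating_map_plus alternating_map_scale
        alternating_map_pullback[OF alt_brG linear_fst]
        alternating_map_pullback[OF alt_omega linear_snd]
        alternating_map_pullback[OF alt_brV linear_snd]
        wedge[OF linear_snd linear_fst lin_theta_V alt_theta_V]
        wedge[OF linear_fst linear_snd lin_rho_V alt_rho_V]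
        wedge[OF linear_snd linear_fst lin_rho_g alt_rho_g]
        wedge[OF linear_fst linear_snd lin_theta_g alt_theta_g] vs_G vs_V)
  then show ?thesis
    by (rule alternating_map_cong) (simp_all add: datum_op_def datum_G_wedge datum_H_wedge)
qed

end

text \<open>
  The compatibility equations for \<open>G\<close> and \<open>H\<close> are the two components of the \<open>n\<close>-Lie identity for
  the operation of the datum, and that operation is alternating for every action datum.
\<close>

lemma compatible_data_iff:
  "D \<in> compatible_data n sG sV brG \<longleftrightarrow> is_action_datum n sG sV D \<and> n_Lie_bracket n scale (op D)"
proof (cases "is_action_datum n sG sV D")
  case True
  define G where "G = datum_G n sG brG D"
  define H where "H = datum_H n sV D"
  have op: "op D zs = (G zs, H zs)" if "length zs = n" for zs
    using that by (simp add: datum_op_def G_def H_def)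
  have key: "(length ws = n - 1 \<and> length zs = n \<longrightarrow>
      op D (ws @ [op D zs]) = (\<Sum>i<n. op D (zs[i := op D (ws @ [zs ! i])]))) \<longleftrightarrow>
    (length ws = n - 1 \<and> length zs = n \<longrightarrow>
      G (ws @ [(G zs, H zs)]) = (\<Sum>i<n. G (zs[i := (G (ws @ [zs ! i]), H (ws @ [zs ! i]))])) \<and>
      H (ws @ [(G zs, H zs)]) = (\<Sum>i<n. H (zs[i := (G (ws @ [zs ! i]), H (ws @ [zs ! i]))])))"
    for ws zs
    using n by (auto simp: op prod_eq_iff fst_sum snd_sum simp del: sum.lessThan_Suc)
  show ?thesis
    unfolding compatible_data_def n_Lie_bracket_def Let_def
    by (simp only: key[unfolded G_def H_def] True alternating_datum_op[OF True] mem_Collect_eq simp_thms)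
qed (simp add: compatible_data_def)

text \<open>
  The list in the sum is \<open>us\<close> followed by a zero for each entry of \<open>xs\<close>. One of two zeros
  survives every omission; a single zero survives all omissions but its own. This covers the
  \<open>rho_V\<close> and \<open>theta_g\<close> parts of the operation.
\<close>

lemma sum_omit_padded:
  fixes sW :: "'k \<Rightarrow> 'w::ab_group_add \<Rightarrow> 'w"
  assumes T: "\<And>a. alternating_map (n - 1) sV sW (T a)" and "vector_space sW"
    and len: "length us + length xs = n"
  shows "(\<Sum>i<n. sW ((-1) ^ (n - 1 - i)) (T (a i) (omit i (us @ map (\<lambda>_. 0) xs)))) =
    (if length xs \<ge> 2 then 0
     else if length xs = 1 then T (a (n - 1)) us
     else (\<Sum>i<n. sW ((-1) ^ (n - 1 - i)) (T (a i) (omit i us))))"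
proof -
  interpret W: vector_space sW by fact
  let ?zs = "us @ map (\<lambda>_. 0) xs"
  have zero: "T b (omit i ?zs) = 0" if "length us \<le> j" "j < n" "i \<noteq> j" for b i j
  proof (rule alternating_map_zero[OF T])
    have "?zs ! j = 0" using that len by (simp add: nth_append)
    then show "0 \<in> set (omit i ?zs)"
      using nth_in_set_omit[of j ?zs i] that len by simp
  qed
  consider (two) "length xs \<ge> 2" | (one) "length xs = 1" | (none) "xs = []"
    by (cases xs) (auto simp: Suc_le_eq)
  then show ?thesis
  proof cases
    case two
    \<comment> \<open>the last two entries are zero, and at most one of them is omitted\<close>
    then have "T b (omit i ?zs) = 0" for b i
      using zero[of "n - 1" i b] zero[of "n - 2" i b] len by (cases "i = n - 1") auto
    then show ?thesis using two by simp
  next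
    case one
    then have us: "length us = n - 1" using len by simp
    have "(\<Sum>i<n. sW ((-1) ^ (n - 1 - i)) (T (a i) (omit i ?zs)))
        = (\<Sum>i\<in>{n - 1}. sW ((-1) ^ (n - 1 - i)) (T (a i) (omit i ?zs)))"
      using zero[of "n - 1"] us n by (intro sum.mono_neutral_right) auto
    moreover have "omit (n - 1) ?zs = us"
      using us one by (auto simp: omit_def)
    ultimately show ?thesis using one by simp
  next
    case none
    then show ?thesis by simp
  qed
qed

text \<open>
  The tuples \<open>(r u, s u), ..., (x, 0), ...\<close> are the images of the sorted tuples under a shear, so this
  evaluation yields the right-hand sides of the conditions (a) to (d). The entries from \<open>\<gg>\<close> have
  \<open>V\<close>-component zero: this cuts the \<open>theta_V\<close> and \<open>rho_g\<close> sums down to the entries from \<open>V\<close>, and kills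
  the terms in \<open>rho_V\<close>, \<open>theta_g\<close>, \<open>omega\<close> and \<open>brV\<close> as soon as there are two entries from \<open>\<gg>\<close>.
\<close>

lemma datum_op_mixed:
  assumes D: "is_action_datum n sG sV D" and len: "length us + length xs = n"
  shows "op D (map (\<lambda>u. (r u, s u)) us @ map in_g xs) =
    (brG (map r us @ xs)
      + (\<Sum>i<length us. sG ((-1) ^ i) (theta_V D (s (us ! i)) (omit i (map r us) @ xs)))
      + (if length xs \<ge> 2 then 0 else if length xs = 1 then rho_V D (map s us) (hd xs)
         else omega D (map s us)
           + (\<Sum>i<n. sG ((-1) ^ (n - 1 - i)) (rho_V D (omit i (map s us)) (r (us ! i))))),
     (\<Sum>i<length us. sV ((-1) ^ (n - 1 - i)) (rho_g D (omit i (map r us) @ xs) (s (us ! i))))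
      + (if length xs \<ge> 2 then 0 else if length xs = 1 then theta_g D (hd xs) (map s us)
         else brV D (map s us)
           + (\<Sum>i<n. sV ((-1) ^ (n - 1 - i)) (theta_g D (r (us ! i)) (omit i (map s us))))))"
proof -
  let ?zs = "map (\<lambda>u. (r u, s u)) us @ map in_g xs"
  let ?xs = "map r us @ xs" and ?us = "map s us @ map (\<lambda>_. 0) xs"
  have fst: "map fst ?zs = ?xs" and snd: "map snd ?zs = ?us"
    by (simp_all add: in_g_def comp_def)
  have head: "(\<Sum>i<n. sW (c i) (T (?us ! i) (omit i ?xs)))
      = (\<Sum>i<length us. sW (c i) (T (s (us ! i)) (omit i (map r us) @ xs)))"
    if T: "\<And>ys. Vector_Spaces.linear sV sW (\<lambda>u. T u ys)"
    for sW :: "'k \<Rightarrow> 'w::ab_group_add \<Rightarrow> 'w" and T c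
  proof -
    have T0: "T 0 ys = 0" for ys
      by (rule linear_map_zero[OF T])
    interpret W: vector_space sW using T by (simp add: Vector_Spaces.linear_iff)
    have "(\<Sum>i<n. sW (c i) (T (?us ! i) (omit i ?xs)))
        = (\<Sum>i<length us. sW (c i) (T (?us ! i) (omit i ?xs)))"
      using len T0
      by (intro sum.mono_neutral_right) (auto simp: nth_append)
    also have "\<dots> = (\<Sum>i<length us. sW (c i) (T (s (us ! i)) (omit i (map r us) @ xs)))"
      by (intro sum.cong refl) (simp add: nth_append omit_append1)
    finally show ?thesis .
  qed
  have last: "?xs ! (n - 1) = hd xs" if "length xs = 1"
    using that len by (cases xs) (auto simp: nth_append)
  have omega0: "omega D ?us = 0" and brV0: "brV D ?us = 0" if "xs \<noteq> []"
    using that alternating_map_zero[OF alt_omega[OF D], of ?us]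
      alternating_map_zero[OF alt_brV[OF D], of ?us] by (cases xs; simp)+
  have nil: "length us = n \<and> xs = []" if "\<not> 2 \<le> length xs" "length xs \<noteq> 1"
    using that len by (cases xs) (auto simp: Suc_le_eq)
  have ne: "xs \<noteq> []" if "2 \<le> length xs \<or> length xs = 1"
    using that by auto
  have G: "datum_G n sG brG D ?zs = brG ?xs
      + (\<Sum>i<length us. sG ((-1) ^ i) (theta_V D (s (us ! i)) (omit i (map r us) @ xs)))
      + (omega D ?us + (\<Sum>i<n. sG ((-1) ^ (n - 1 - i)) (rho_V D (omit i ?us) (?xs ! i))))"
    unfolding datum_G_def Let_def fst snd
      head[of sG "theta_V D" "\<lambda>i. (-1) ^ i", OF lin_theta_V[OF D]] by (simp only: ac_simps)
  have H: "datum_H n sV D ?zs =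
      (\<Sum>i<length us. sV ((-1) ^ (n - 1 - i)) (rho_g D (omit i (map r us) @ xs) (s (us ! i))))
      + (brV D ?us + (\<Sum>i<n. sV ((-1) ^ (n - 1 - i)) (theta_g D (?xs ! i) (omit i ?us))))"
    unfolding datum_H_def Let_def fst snd
      head[of sV "\<lambda>u xs. rho_g D xs u" "\<lambda>i. (-1) ^ (n - 1 - i)",
        OF lin_rho_g[OF D]] by (simp only: ac_simps)
  have len': "length (map s us) + length xs = n" using len by simp
  have G': "omega D ?us + (\<Sum>i<n. sG ((-1) ^ (n - 1 - i)) (rho_V D (omit i ?us) (?xs ! i))) =
      (if length xs \<ge> 2 then 0 else if length xs = 1 then rho_V D (map s us) (hd xs)
         else omega D (map s us)
           + (\<Sum>i<n. sG ((-1) ^ (n - 1 - i)) (rho_V D (omit i (map s us)) (r (us ! i)))))"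
    unfolding sum_omit_padded[where T = "\<lambda>x us. rho_V D us x" and a = "\<lambda>i. ?xs ! i",
        OF alt_rho_V[OF D] vs_G len']
    using omega0 last nil ne by (auto simp del: sum.lessThan_Suc intro!: sum.cong)
  have H': "brV D ?us + (\<Sum>i<n. sV ((-1) ^ (n - 1 - i)) (theta_g D (?xs ! i) (omit i ?us))) =
      (if length xs \<ge> 2 then 0 else if length xs = 1 then theta_g D (hd xs) (map s us)
         else brV D (map s us)
           + (\<Sum>i<n. sV ((-1) ^ (n - 1 - i)) (theta_g D (r (us ! i)) (omit i (map s us)))))"
    unfolding sum_omit_padded[where T = "theta_g D" and a = "\<lambda>i. ?xs ! i",
        OF alt_theta_g[OF D] vs_V len']
    using brV0 last nil ne by (auto simp del: sum.lessThan_Suc intro!: sum.cong)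
  show ?thesis
    using len unfolding datum_op_def G H G' H' by simp
qed

text \<open>
  The case \<open>r = 0\<close>, \<open>s = id\<close> of the previous evaluation. With \<open>k\<close> entries in \<open>V\<close>, only the components
  of the datum for \<open>k = 1\<close>, \<open>k = n - 1\<close> and \<open>k = n\<close> can contribute; for \<open>n = 2\<close> the first two cases
  coincide and their contributions add up.
\<close>

lemma datum_op_pure:
  assumes D: "is_action_datum n sG sV D" and len: "length us + length xs = n"
  shows "op D (map in_V us @ map in_g xs) =
    ((if us = [] then brG xs else 0)
      + (if length us = 1 then theta_V D (hd us) xs else 0)
      + (if length xs = 1 then rho_V D us (hd xs) else 0)
      + (if xs = [] then omega D us else 0),
     (if length us = 1 then sV ((-1) ^ (n - 1)) (rho_g D xs (hd us)) else 0)
      + (if length xs = 1 then theta_g D (hd xs) us else 0)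
      + (if xs = [] then brV D us else 0))"
proof -
  let ?O = "map (\<lambda>_. 0 :: 'g) us"
  have brG0: "brG (?O @ xs) = (if us = [] then brG xs else 0)"
    using alternating_map_zero[OF alt_brG, of "?O @ xs"] by (cases us) auto
  have head: "(\<Sum>i<length us. sW (c i) (T (us ! i) (omit i ?O @ xs)))
      = (if length us = 1 then sW (c 0) (T (hd us) xs) else 0)"
    if T: "\<And>u. alternating_map (n - 1) sG sW (T u)" and W: "vector_space sW"
    for sW :: "'k \<Rightarrow> 'w::ab_group_add \<Rightarrow> 'w" and T c
  proof -
    interpret W: vector_space sW by fact
    show ?thesis
    proof (cases "length us = 1")
      case True
      then obtain u where "us = [u]" by (cases us) auto
      then show ?thesis by (simp add: omit_def)
    next
      case False
      have "T (us ! i) (omit i ?O @ xs) = 0" if i: "i < length us" for i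
      proof (rule alternating_map_zero[OF T])
        \<comment> \<open>with at least two entries in \<open>V\<close>, a zero at some position \<open>j\<close> other than \<open>i\<close> is left\<close>
        define j where "j = (if i = 0 then 1 else 0 :: nat)"
        have "j < length us" "i \<noteq> j"
          using False i by (auto simp: j_def)
        then show "0 \<in> set (omit i ?O @ xs)"
          using nth_in_set_omit[of j ?O i] by simp
      qed
      then show ?thesis
        using False by simp
    qed
  qed
  have rho0: "rho_V D ys 0 = 0" and theta0: "theta_g D 0 ys = 0" for ys
    by (rule linear_map_zero[OF lin_rho_V[OF D]] linear_map_zero[OF lin_theta_g[OF D]])+
  have nil: "xs = []" if "\<not> 2 \<le> length xs" "length xs \<noteq> 1"
    using that by (cases xs) (auto simp: Suc_le_eq)
  have in_V: "map in_V us = map (\<lambda>u. (0, u)) us"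
    by (simp add: in_V_def)
  show ?thesis
    unfolding in_V datum_op_mixed[OF D len, of "\<lambda>_. 0" "\<lambda>u. u"]
      brG0 rho0 theta0
      head[of sG "theta_V D" "\<lambda>i. (-1) ^ i", OF alt_theta_V[OF D] vs_G]
      head[of sV "\<lambda>u xs. rho_g D xs u" "\<lambda>i. (-1) ^ (n - 1 - i)",
        OF alt_rho_g[OF D] vs_V]
    using nil by auto
qed

section \<open>Conditions (a) to (d) as a morphism condition\<close>

text \<open>
  Being a morphism on tuples with \<open>k\<close> entries in \<open>V\<close> is condition (a) for \<open>k = 1\<close>, (b) for
  \<open>2 \<le> k \<le> n - 2\<close>, (c) for \<open>k = n - 1\<close> and (d) for \<open>k = n\<close>; for \<open>n = 2\<close> the cases of (a) and (c)
  are one and the same, which is why a single condition replaces them. For \<open>k = 0\<close> the morphism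
  equation always holds, because both operations restrict to the bracket of \<open>\<gg>\<close> and the shear fixes
  \<open>\<gg>\<close> pointwise.
\<close>

lemma shear_on_pure_iff_conds:
  assumes D: "is_action_datum n sG sV D" and D': "is_action_datum n sG sV D'"
    and r: "Vector_Spaces.linear sV sG r" and s: "Vector_Spaces.linear sV sV s"
  shows "(\<forall>us xs. length us + length xs = n \<longrightarrow>
      shear r s (op D (map in_V us @ map in_g xs)) = op D' (map (shear r s) (map in_V us @ map in_g xs)))
    \<longleftrightarrow> conds D D' r s"
proof -
  define P where "P us xs \<longleftrightarrow>
      shear r s (op D (map in_V us @ map in_g xs))
      = op D' (map (shear r s) (map in_V us @ map in_g xs))" for us xs
  have r0: "r 0 = 0" and s0: "s 0 = 0"
    and r_scale: "r (sV c u) = sG c (r u)" and s_scale: "s (sV c u) = sV c (s u)" for c u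
    using linear_map_zero[OF r] linear_map_zero[OF s] r s by (simp_all add: Vector_Spaces.linear_iff)
  have map: "map (shear r s) (map in_V us @ map in_g xs)
      = map (\<lambda>u. (r u, s u)) us @ map in_g xs" for us xs
    by (simp add: shear_def in_V_def in_g_def r0 s0)
  note eval = datum_op_pure[OF D] datum_op_mixed[OF D', of _ _ r s]
  have P0: "P [] xs" if "length xs = n" for xs
  proof -
    have len: "length ([] :: 'v list) + length xs = n" and "xs \<noteq> []" "length xs \<noteq> 1" "2 \<le> length xs"
      using that n by auto
    then show ?thesis
      unfolding P_def map eval[OF len] unfolding shear_def by (simp add: r0 s0)
  qed
  have cond_a: "(\<forall>u xs. length xs = n - 1 \<longrightarrow> P [u] xs) \<longleftrightarrow> cond_a n sG brG D D' r s"
    if "n \<noteq> 2"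
  proof -
    have "P [u] xs \<longleftrightarrow> theta_V D u xs + sG ((-1) ^ (n - 1)) (r (rho_g D xs u))
          = brG (r u # xs) + theta_V D' (s u) xs \<and>
        s (rho_g D xs u) = rho_g D' xs (s u)" if xs: "length xs = n - 1" for u xs
    proof -
      have len: "length [u] + length xs = n" and "length xs \<noteq> 1" "2 \<le> length xs" "xs \<noteq> []"
        using xs \<open>n \<noteq> 2\<close> n by auto
      then show ?thesis
        unfolding P_def map eval[OF len] unfolding shear_def
        by (simp add: omit_def r_scale s_scale)
    qed
    then show ?thesis unfolding cond_a_def by blast
  qed
  have cond_b: "(\<forall>us xs. 2 \<le> length us \<and> length us + 2 \<le> n \<and> length us + length xs = n \<longrightarrow> P us xs)
      \<longleftrightarrow> cond_b n sG sV brG D' r s"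
  proof -
    have "P us xs \<longleftrightarrow>
        0 = brG (map r us @ xs)
            + (\<Sum>i<length us. sG ((-1) ^ i) (theta_V D' (s (us ! i)) (omit i (map r us) @ xs))) \<and>
        0 = (\<Sum>i<length us.
               sV ((-1) ^ (n - 1 - i)) (rho_g D' (omit i (map r us) @ xs) (s (us ! i))))"
      if us: "2 \<le> length us \<and> length us + 2 \<le> n \<and> length us + length xs = n" for us xs
    proof -
      have len: "length us + length xs = n" and "length us \<noteq> 1" "us \<noteq> []" "length xs \<noteq> 1"
          "2 \<le> length xs" "xs \<noteq> []"
        using us by auto
      then show ?thesis
        unfolding P_def map eval[OF len] unfolding shear_def
        by (simp add: r0 s0)
    qed
    then show ?thesis unfolding cond_b_def by blast
  qed
  have cond_c: "(\<forall>us x. length us = n - 1 \<longrightarrow> P us [x]) \<longleftrightarrow> cond_c n sG sV brG D D' r s"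
    if "n \<noteq> 2"
  proof -
    have "P us [x] \<longleftrightarrow> rho_V D us x + r (theta_g D x us)
          = brG (map r us @ [x])
            + (\<Sum>i<n - 1. sG ((-1) ^ i) (theta_V D' (s (us ! i)) (omit i (map r us) @ [x])))
            + rho_V D' (map s us) x \<and>
        s (theta_g D x us)
          = (\<Sum>i<n - 1.
               sV ((-1) ^ (n - 1 - i)) (rho_g D' (omit i (map r us) @ [x]) (s (us ! i))))
            + theta_g D' x (map s us)" if us: "length us = n - 1" for us x
    proof -
      have len: "length us + length [x] = n" and "length us \<noteq> 1" "us \<noteq> []"
        using us \<open>n \<noteq> 2\<close> n by auto
      then show ?thesis
        unfolding P_def map eval[OF len] unfolding shear_def us[symmetric]
        by simp
    qed
    then show ?thesis unfolding cond_c_def by blast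
  qed
  have cond_d: "(\<forall>us. length us = n \<longrightarrow> P us []) \<longleftrightarrow> cond_d n sG sV brG D D' r s"
  proof -
    have "P us [] \<longleftrightarrow> omega D us + r (brV D us)
          = brG (map r us) + omega D' (map s us)
            + (\<Sum>i<n. sG ((-1) ^ i) (theta_V D' (s (us ! i)) (omit i (map r us))))
            + (\<Sum>i<n. sG ((-1) ^ (n - 1 - i)) (rho_V D' (omit i (map s us)) (r (us ! i)))) \<and>
        s (brV D us)
          = brV D' (map s us)
            + (\<Sum>i<n. sV ((-1) ^ (n - 1 - i)) (rho_g D' (omit i (map r us)) (s (us ! i))))
            + (\<Sum>i<n. sV ((-1) ^ (n - 1 - i)) (theta_g D' (r (us ! i)) (omit i (map s us))))"
      if us: "length us = n" for us
    proof -
      have len: "length us + length ([] :: 'g list) = n" and "length us \<noteq> 1" "us \<noteq> []"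
        using us n by auto
      then show ?thesis
        unfolding P_def map eval[OF len] unfolding shear_def us
        by (simp add: ac_simps del: sum.lessThan_Suc)
    qed
    then show ?thesis unfolding cond_d_def by blast
  qed
  have cond_ac2: "(\<forall>u x. P [u] [x]) \<longleftrightarrow> cond_ac2 brG D D' r s" if "n = 2"
  proof -
    have "P [u] [x] \<longleftrightarrow>
        theta_V D u [x] + rho_V D [u] x + r (theta_g D x [u] - rho_g D [x] u)
          = brG [r u, x] + theta_V D' (s u) [x] + rho_V D' [s u] x \<and>
        s (theta_g D x [u] - rho_g D [x] u) = theta_g D' x [s u] - rho_g D' [x] (s u)" for u x
    proof -
      have len: "length [u] + length [x] = n" using that by simp
      then show ?thesis
        unfolding P_def map eval[OF len] unfolding shear_def
        by (simp add: that omit_def)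
    qed
    then show ?thesis unfolding cond_ac2_def by blast
  qed
  have split: "(\<forall>us xs. length us + length xs = n \<longrightarrow> P us xs) \<longleftrightarrow>
      (\<forall>u xs. length xs = n - 1 \<longrightarrow> P [u] xs) \<and>
      (\<forall>us xs. 2 \<le> length us \<and> length us + 2 \<le> n \<and> length us + length xs = n \<longrightarrow> P us xs) \<and>
      (\<forall>us x. length us = n - 1 \<longrightarrow> P us [x]) \<and>
      (\<forall>us. length us = n \<longrightarrow> P us [])" (is "?L \<longleftrightarrow> ?A \<and> ?B \<and> ?C \<and> ?Z")
  proof
    assume ?L then show "?A \<and> ?B \<and> ?C \<and> ?Z" using n by auto
  next
    assume R: "?A \<and> ?B \<and> ?C \<and> ?Z"
    show ?L
    proof (intro allI impI)
      fix us :: "'v list" and xs :: "'g list" assume len: "length us + length xs = n"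
      consider "us = []" | u where "us = [u]" | "xs = []" | x where "xs = [x]"
        | "2 \<le> length us" "2 \<le> length xs"
        by (cases us; cases "tl us"; cases xs; cases "tl xs") auto
      then show "P us xs"
        using R P0 len by cases auto
    qed
  qed
  have split2: "(\<forall>u xs. length xs = n - 1 \<longrightarrow> P [u] xs) \<longleftrightarrow> (\<forall>u x. P [u] [x])"
    "(\<forall>us x. length us = n - 1 \<longrightarrow> P us [x]) \<longleftrightarrow> (\<forall>u x. P [u] [x])" if "n = 2"
    using that by (auto simp: length_Suc_conv)
  have "(\<forall>us xs. length us + length xs = n \<longrightarrow> P us xs) \<longleftrightarrow> conds D D' r s"
    unfolding split datum_conditions_def using split2 cond_a cond_b cond_c cond_d cond_ac2
    by (cases "n = 2") auto
  then show ?thesis unfolding P_def .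
qed

text \<open>
  Both sides of the morphism equation are alternating maps on \<open>E\<close>, so they agree as soon as they
  agree on sorted tuples.
\<close>

lemma shear_hom_iff_conds:
  assumes D: "is_action_datum n sG sV D" and D': "is_action_datum n sG sV D'"
    and r: "Vector_Spaces.linear sV sG r" and s: "Vector_Spaces.linear sV sV s"
  shows "(\<forall>zs. length zs = n \<longrightarrow> shear r s (op D zs) = op D' (map (shear r s) zs))
    \<longleftrightarrow> conds D D' r s"
proof
  assume "\<forall>zs. length zs = n \<longrightarrow> shear r s (op D zs) = op D' (map (shear r s) zs)"
  then show "conds D D' r s"
    unfolding shear_on_pure_iff_conds[OF assms, symmetric] by simp
next
  assume c: "conds D D' r s"
  have lin: "Vector_Spaces.linear scale scale (shear r s)"
    using linear_fixing_g_iff_shear[OF vs_G vs_V] r s by blast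
  show "\<forall>zs. length zs = n \<longrightarrow> shear r s (op D zs) = op D' (map (shear r s) zs)"
  proof (intro allI impI)
    fix zs :: "('g \<times> 'v) list" assume "length zs = n"
    with alternating_map_eqI[OF alternating_map_compose[OF alternating_datum_op[OF D] lin]
        alternating_map_pullback[OF alternating_datum_op[OF D'] lin] vs_E, of zs]
    show "shear r s (op D zs) = op D' (map (shear r s) zs)"
      using c unfolding shear_on_pure_iff_conds[OF assms, symmetric] by blast
  qed
qed

section \<open>The datum of an extreme extending structure\<close>

text \<open>
  For \<open>n = 2\<close> the single bracket \<open>[u, x]\<close> determines only the sums of the contributions of \<open>theta_V\<close>
  and \<open>rho_V\<close>, and of \<open>rho_g\<close> and \<open>theta_g\<close>. It is then attributed to \<open>theta_V\<close> and \<open>rho_g\<close> alone. The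
  sign in \<open>rho_g\<close> cancels the sign \<open>(-1)^(n-1)\<close> with which it enters the operation at the first
  position.
\<close>

definition datum_of :: "(('g \<times> 'v) list \<Rightarrow> 'g \<times> 'v) \<Rightarrow> ('g, 'v) action_datum" where
  "datum_of br =
     \<lparr>rho_g = (\<lambda>xs u. sV ((-1) ^ (n - 1)) (snd (br (in_V u # map in_g xs)))),
      rho_V = (\<lambda>us x. if n = 2 then 0 else fst (br (map in_V us @ [in_g x]))),
      theta_V = (\<lambda>u xs. fst (br (in_V u # map in_g xs))),
      theta_g = (\<lambda>x us. if n = 2 then 0 else snd (br (map in_V us @ [in_g x]))),
      omega = (\<lambda>us. fst (br (map in_V us))),
      brV = (\<lambda>us. snd (br (map in_V us)))\<rparr>"

lemma linear_in_g: "Vector_Spaces.linear sG scale in_g"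
  and linear_in_V: "Vector_Spaces.linear sV scale in_V"
  unfolding Vector_Spaces.linear_iff using vs_G vs_V vs_E
  by (simp_all add: in_g_def in_V_def scale_prod)

lemma is_action_datum_of:
  assumes br: "alternating_map n scale scale br"
  shows "is_action_datum n sG sV (datum_of br)"
proof -
  have brS: "alternating_map (Suc (n - 1)) scale scale br"
    using br n by simp
  have first: "alternating_map (n - 1) sG scale (\<lambda>xs. br (in_V u # map in_g xs))" for u
    using alternating_map_pullback[OF alternating_map_Cons[OF brS] linear_in_g] .
  have last: "alternating_map (n - 1) sV scale (\<lambda>us. br (map in_V us @ [in_g x]))" for x
    using alternating_map_pullback[OF alternating_map_snoc[OF brS] linear_in_V] .
  have all: "alternating_map n sV scale (\<lambda>us. br (map in_V us))"
    using alternating_map_pullback[OF br linear_in_V] .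
  have lin_V: "Vector_Spaces.linear sV scale (\<lambda>u. br (in_V u # zs))" for zs
    using Vector_Spaces.linear_compose[OF linear_in_V
        alternating_map_linear_any[OF br vs_E vs_E, of "[]" zs]] by (simp add: comp_def)
  have lin_g: "Vector_Spaces.linear sG scale (\<lambda>x. br (zs @ [in_g x]))" for zs
    using Vector_Spaces.linear_compose[OF linear_in_g
        alternating_map_linear_any[OF br vs_E vs_E, of zs "[]"]] by (simp add: comp_def)
  have fst: "Vector_Spaces.linear sA sG (\<lambda>y. fst (h y))"
    and snd: "Vector_Spaces.linear sA sV (\<lambda>y. snd (h y))"
    if "Vector_Spaces.linear sA scale h" for h and sA :: "'k \<Rightarrow> 'a::ab_group_add \<Rightarrow> 'a"
    using Vector_Spaces.linear_compose[OF that linear_fst]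
      Vector_Spaces.linear_compose[OF that linear_snd] by (simp_all add: comp_def)
  have sign: "Vector_Spaces.linear sV sV (\<lambda>u. sV c (snd (br (in_V u # zs))))" for c zs
    using snd[OF lin_V[of zs]]
    by (intro vector_space_pair.linear_compose_scale_right) (simp_all add: vector_space_pair_def vs_V)
  have rho_V: "alternating_map (n - 1) sV sG
      (\<lambda>us. if n = 2 then 0 else fst (br (map in_V us @ [in_g x])))"
    and theta_g: "alternating_map (n - 1) sV sV
      (\<lambda>us. if n = 2 then 0 else snd (br (map in_V us @ [in_g x])))" for x
    using alternating_map_compose[OF last linear_fst] alternating_map_compose[OF last linear_snd]
    by (cases "n = 2"; simp add: alternating_map_null vs_G vs_V)+
  have rho_V': "Vector_Spaces.linear sG sG
      (\<lambda>x. if n = 2 then 0 else fst (br (map in_V us @ [in_g x])))"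
    and theta_g': "Vector_Spaces.linear sG sV
      (\<lambda>x. if n = 2 then 0 else snd (br (map in_V us @ [in_g x])))" for us
    using fst[OF lin_g] snd[OF lin_g]
    by (cases "n = 2";
        simp add: vector_space_pair.linear_zero vector_space_pair_def vs_G vs_V)+
  show ?thesis
    unfolding is_action_datum_def datum_of_def action_datum.simps
    by (intro conjI allI rho_V rho_V' theta_g theta_g' sign fst[OF lin_V]
        alternating_map_scale vs_V
        alternating_map_compose[OF first linear_fst] alternating_map_compose[OF first linear_snd]
        alternating_map_compose[OF all linear_fst] alternating_map_compose[OF all linear_snd])
qed

text \<open>
  Both brackets are alternating. On sorted tuples the components are those read off, or the value is
  prescribed by the definition of an extreme extending structure.
\<close>

lemma datum_op_datum_of:
  assumes "br \<in> struct"
  shows "op (datum_of br) = br"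
proof
  have br: "alternating_map n scale scale br"
    and br_g: "\<And>xs. length xs = n \<Longrightarrow> br (map in_g xs) = in_g (brG xs)"
    and br_0: "\<And>us xs. 2 \<le> length us \<Longrightarrow> length us + 2 \<le> n \<Longrightarrow> length us + length xs = n \<Longrightarrow>
      br (map in_V us @ map in_g xs) = 0"
    using assms by (auto simp: extreme_extending_structures_def n_Lie_bracket_def)
  have D: "is_action_datum n sG sV (datum_of br)"
    by (rule is_action_datum_of[OF br])
  have sign: "sV ((-1) ^ k) (sV ((-1) ^ k) v) = v" for k v
    by (simp flip: power_mult_distrib)
  fix zs
  show "op (datum_of br) zs = br zs"
  proof (cases "length zs = n")
    case True
    show ?thesis
    proof (rule alternating_map_eqI[OF alternating_datum_op[OF D] br vs_E _ True])
      fix us :: "'v list" and xs :: "'g list" assume len: "length us + length xs = n"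
      consider "us = []" | u where "us = [u]" "n = 2" | u where "us = [u]" "n \<noteq> 2"
        | "xs = []" "us \<noteq> []" "length us \<noteq> 1"
        | x where "xs = [x]" "n \<noteq> 2" "us \<noteq> []" "length us \<noteq> 1"
        | "2 \<le> length us" "2 \<le> length xs"
        using len n by (cases us; cases "tl us"; cases xs; cases "tl xs"; force)
      then show "op (datum_of br) (map in_V us @ map in_g xs) = br (map in_V us @ map in_g xs)"
        unfolding datum_op_pure[OF D len] unfolding datum_of_def action_datum.simps
        using len n br_g[of xs] br_0[of us xs]
        by cases (auto simp: sign in_g_def prod_eq_iff)
    qed
  next
    case False
    then show ?thesis
      by (simp add: datum_op_def alternating_map_length[OF br])
  qed
qed

lemma datum_op_in_struct:
  assumes "D \<in> compatible_data n sG sV brG"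
  shows "op D \<in> struct"
proof -
  have D: "is_action_datum n sG sV D" and L: "n_Lie_bracket n scale (op D)"
    using assms by (simp_all add: compatible_data_iff)
  have "op D (map in_g xs) = in_g (brG xs)" if "length xs = n" for xs
    using datum_op_pure[OF D, of "[]" xs] that n by (auto simp: in_g_def)
  moreover have "op D (map in_V us @ map in_g xs) = 0"
    if "2 \<le> length us \<and> length us + 2 \<le> n \<and> length us + length xs = n" for us xs
    using datum_op_pure[OF D, of us xs] that by (auto simp: zero_prod_def)
  ultimately show ?thesis
    using L by (simp add: extreme_extending_structures_def)
qed

lemma datum_op_image: "op ` compatible_data n sG sV brG = struct"
proof
  show "op ` compatible_data n sG sV brG \<subseteq> struct"
    using datum_op_in_struct by blast
  show "struct \<subseteq> op ` compatible_data n sG sV brG"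
  proof
    fix br assume br: "br \<in> struct"
    then have "n_Lie_bracket n scale br"
      by (simp add: extreme_extending_structures_def)
    then have "datum_of br \<in> compatible_data n sG sV brG"
      unfolding compatible_data_iff datum_op_datum_of[OF br]
      by (simp add: is_action_datum_of n_Lie_bracket_def)
    then show "br \<in> op ` compatible_data n sG sV brG"
      by (rule rev_image_eqI) (simp add: datum_op_datum_of[OF br])
  qed
qed

lemma data_isomorphic_iff:
  assumes "D \<in> compatible_data n sG sV brG" and "D' \<in> compatible_data n sG sV brG"
  shows "data_isomorphic n sG sV brG D D'
    \<longleftrightarrow> structures_isomorphic_over_g n sG sV (op D) (op D')"
  using assms shear_hom_iff_conds[of D D']
  unfolding data_isomorphic_def structures_isomorphic_over_g_iff_shear[OF vs_G vs_V]
    compatible_data_iff by blast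

lemma data_equivalent_iff:
  assumes "D \<in> compatible_data n sG sV brG" and "D' \<in> compatible_data n sG sV brG"
  shows "data_equivalent n sG sV brG D D' \<longleftrightarrow> structures_equivalent n sG sV (op D) (op D')"
  using assms shear_hom_iff_conds[of D D' _ id] vs2.linear_id
  unfolding data_equivalent_def structures_equivalent_iff_shear[OF vs_G vs_V]
    compatible_data_iff by blast

end

section \<open>Passage to classes\<close>

text \<open>
  A surjection that preserves and reflects the relations pulls the equivalence relation back, and
  induces a bijection of the classes.
\<close>

lemma classifies_viaI:
  assumes im: "f ` A = B" and S: "equiv B (rel_on B S)"
    and iff: "\<And>a b. a \<in> A \<Longrightarrow> b \<in> A \<Longrightarrow> R a b \<longleftrightarrow> S (f a) (f b)"
  shows "classifies_via f A R B S"
proof -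
  let ?r = "rel_on A R" and ?s = "rel_on B S"
  have rs: "(a, b) \<in> ?r \<longleftrightarrow> a \<in> A \<and> b \<in> A \<and> (f a, f b) \<in> ?s" for a b
    using iff im by (auto simp: rel_on_def)
  have r: "equiv A ?r"
  proof (rule equivI)
    show "?r \<subseteq> A \<times> A" by (auto simp: rel_on_def)
    show "refl_on A ?r"
      using S im rs by (auto simp: equiv_def refl_on_def)
    show "sym ?r"
      using S rs by (auto simp: equiv_def sym_def)
    show "trans ?r"
      using S rs unfolding equiv_def trans_def by blast
  qed
  have cls: "?s `` (f ` (?r `` {a})) = ?s `` {f a}" if "a \<in> A" for a
  proof
    show "?s `` (f ` (?r `` {a})) \<subseteq> ?s `` {f a}"
      using rs S unfolding equiv_def trans_def by blast
    show "?s `` {f a} \<subseteq> ?s `` (f ` (?r `` {a}))"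
      using that equiv_class_self[OF r that] by blast
  qed
  have "bij_betw (\<lambda>C. ?s `` (f ` C)) (A // ?r) (B // ?s)"
    unfolding bij_betw_def
  proof
    show "inj_on (\<lambda>C. ?s `` (f ` C)) (A // ?r)"
    proof (rule inj_onI)
      fix C D assume C: "C \<in> A // ?r" and D: "D \<in> A // ?r"
        and eq: "?s `` (f ` C) = ?s `` (f ` D)"
      obtain a b where a: "a \<in> A" "C = ?r `` {a}" and b: "b \<in> A" "D = ?r `` {b}"
        using C D by (auto elim!: quotientE)
      have "?s `` {f a} = ?s `` {f b}"
        using eq a b cls by simp
      then have "(f a, f b) \<in> ?s"
        using eq_equiv_class[OF _ S, of "f a" "f b"] b(1) im by blast
      then have "(a, b) \<in> ?r"
        using a(1) b(1) rs by blast
      then show "C = D"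
        using a b equiv_class_eq[OF r] by blast
    qed
    show "(\<lambda>C. ?s `` (f ` C)) ` (A // ?r) = B // ?s"
    proof -
      have "(\<lambda>C. ?s `` (f ` C)) ` (A // ?r) = (\<lambda>a. ?s `` {f a}) ` A"
        unfolding quotient_def using cls by (force simp: image_UN)
      also have "\<dots> = B // ?s"
        unfolding quotient_def im[symmetric] by auto
      finally show ?thesis .
    qed
  qed
  then show ?thesis
    using im r S by (simp add: classifies_via_def)
qed

theorem corollary4p5:
  fixes sG :: "'k::field_char_0 \<Rightarrow> 'g::ab_group_add \<Rightarrow> 'g"
    and sV :: "'k \<Rightarrow> 'v::ab_group_add \<Rightarrow> 'v"
    and brG :: "'g list \<Rightarrow> 'g"
    and n :: nat
  assumes "n \<ge> 2"
    and "vector_space sG"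
    and "vector_space sV"
    and "n_Lie_bracket n sG brG"
  shows "classifies_via (datum_op n sG sV brG)
           (compatible_data n sG sV brG) (data_equivalent n sG sV brG)
           (extreme_extending_structures n sG sV brG) (structures_equivalent n sG sV)
       \<and> classifies_via (datum_op n sG sV brG)
           (compatible_data n sG sV brG) (data_isomorphic n sG sV brG)
           (extreme_extending_structures n sG sV brG) (structures_isomorphic_over_g n sG sV)"
proof -
  interpret split_extension sG sV brG n
    using assms by (simp add: split_extension_def split_extension_axioms_def
        vector_space_prod_def vector_space_pair_def)
  show ?thesis
    by (intro conjI classifies_viaI datum_op_image structures_equivalent_equiv[OF vs_E]
        structures_isomorphic_over_g_equiv[OF vs_E] data_equivalent_iff data_isomorphic_iff)
qed

end
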